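(* Let $n,p$ be positive integers. The metric space $(\mathbb{H}^{n\times n\times p}_{++},\delta)$ has nonpositive curvature, i.e., is a CAT(0) space, where $\delta$ is the Riemannian distance of the metric $g_{\mathcal{P}}(\mathcal{X},\mathcal{Y})=\operatorname{tr}(\mathcal{P}^{-1}*\mathcal{X}*\mathcal{P}^{-1}*\mathcal{Y})$ on the manifold $\mathbb{H}^{n\times n\times p}_{++}$ of T-positive definite tensors.
   Context: A tensor $\mathcal{A}\in\mathbb{C}^{m\times n\times p}$ has frontal slices $A^{(1)},\dots,A^{(p)}\in\mathbb{C}^{m\times n}$. $\operatorname{bcirc}(\mathcal{A})\in\mathbb{C}^{mp\times np}$ is the block circulant matrix whose $(j,l)$ block is $A^{(((j-l)\bmod p)+1)}$ (first block column $A^{(1)},\dots,A^{(p)}$); $\operatorname{unfold}(\mathcal{A})$ is the block column $A^{(1)},\dots,A^{(p)}$, and $\operatorname{fold}$ is its inverse. The T-product is $\mathcal{A}*\mathcal{B}=\operatorname{fold}(\operatorname{bcirc}(\mathcal{A})\cdot\operatorname{unfold}(\mathcal{B}))$; inverses are with respect to $*$ and the identity tensor $\mathcal{I}_{n,p}$ (first frontal slice $I_n$, others zero). The T-conjugate transpose $\mathcal{A}^H$ has frontal slices $(A^{(1)})^H,(A^{(p)})^H,\dots,(A^{(2)})^H$. $\mathbb{H}^{n\times n\times p}$ is the real vector space of T-Hermitian tensors ($\mathcal{A}\in\mathbb{C}^{n\times n\times p}$, $\mathcal{A}^H=\mathcal{A}$). With $\langle\mathcal{A},\mathcal{B}\rangle=\sum_{i,j,k}\overline{a_{ijk}}b_{ijk}$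 and $\|\mathcal{A}\|=\sqrt{\langle\mathcal{A},\mathcal{A}\rangle}$, $\mathbb{H}^{n\times n\times p}_{++}$ is the set of T-positive definite tensors, i.e. $\mathcal{A}\in\mathbb{H}^{n\times n\times p}$ with $\langle\mathcal{X},\mathcal{A}*\mathcal{X}\rangle>0$ for all nonzero $\mathcal{X}\in\mathbb{C}^{n\times1\times p}$ (equivalently, $\operatorname{bcirc}(\mathcal{A})$ is Hermitian positive definite). It is an open convex cone in $\mathbb{H}^{n\times n\times p}$, hence a smooth manifold with tangent spaces $\mathbb{H}^{n\times n\times p}$. The trace is $\operatorname{tr}(\mathcal{A})=\operatorname{tr}(\operatorname{bcirc}(\mathcal{A}))$. The length with respect to $g$ of a piecewise smooth path $\gamma:[a,b]\to\mathbb{H}^{n\times n\times p}_{++}$ is $L(\gamma)=\int_a^b\sqrt{g_{\gamma(t)}(\gamma'(t),\gamma'(t))}\,dt=\sqrt p\int_a^b\|\gamma(t)^{-1/2}*\gamma'(t)*\gamma(t)^{-1/2}\|\,dt$ (where $\mathcal{P}^{-1/2}$ is the inverse of the unique T-positive definite square root of $\mathcal{P}$), and $\delta(\mathcal{A},\mathcal{B})=\inf\{L(\gamma)\mid\gamma\text{ a piecewise smooth path from }\mathcal{A}\text{ to }\mathcal{B}\}$. *)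

theory Defs
  imports "HOL-Analysis.Analysis" "Berlekamp_Zassenhaus.Finite_Field"
begin

text \<open>
  A tensor in \<open>\<complex>\<^bsup>m\<times>n\<times>p\<^esup>\<close> has \<open>m = CARD('m)\<close>, \<open>n = CARD('n)\<close>, \<open>p = CARD('p)\<close>.  Its frontal
  slices are indexed by \<open>'p mod_ring\<close>, the cyclic group \<open>\<int>/p\<int>\<close>: the slice \<open>A\<^sup>(\<^sup>k\<^sup>+\<^sup>1\<^sup>)\<close> is \<open>A $ k\<close>
  for \<open>k = 0, \<dots>, p - 1\<close>, so that index arithmetic modulo \<open>p\<close> is subtraction in \<open>'p mod_ring\<close>.
  The norm which the type carries as an iterated \<open>\<^typ>\<open>'a ^ 'b\<close>\<close> is the Frobenius norm.
\<close>

type_synonym ('m, 'n, 'p) tensor = "complex ^ 'n ^ 'm ^ ('p mod_ring)"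

text \<open>Rows and columns of the block matrices are indexed by pairs (block, position in the block).\<close>

definition bcirc :: "('m, 'n, 'p::finite) tensor \<Rightarrow>
    complex ^ ('p mod_ring \<times> 'n::finite) ^ ('p mod_ring \<times> 'm::finite)" where
  "bcirc A = (\<chi> r c. A $ (fst r - fst c) $ snd r $ snd c)"

definition tunfold :: "('m, 'n, 'p::finite) tensor \<Rightarrow>
    complex ^ 'n::finite ^ ('p mod_ring \<times> 'm::finite)" where
  "tunfold A = (\<chi> r j. A $ fst r $ snd r $ j)"

definition tfold :: "complex ^ 'n::finite ^ ('p::finite mod_ring \<times> 'm::finite) \<Rightarrow>
    ('m, 'n, 'p) tensor" where
  "tfold M = (\<chi> k i j. M $ (k, i) $ j)"

definition tprod :: "('m::finite, 'n::finite, 'p::finite) tensor \<Rightarrow> ('n, 'l::finite, 'p) tensor \<Rightarrow>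
    ('m, 'l, 'p) tensor"  (infixl \<open>\<star>\<close> 70) where
  "A \<star> B = tfold (bcirc A ** tunfold B)"

definition tident :: "('n::finite, 'n, 'p::finite) tensor" where
  "tident = (\<chi> k. if k = 0 then mat 1 else 0)"

definition tinv :: "('n::finite, 'n, 'p::finite) tensor \<Rightarrow> ('n, 'n, 'p) tensor" where
  "tinv A = (THE B. A \<star> B = tident \<and> B \<star> A = tident)"

definition conj_transpose :: "complex ^ 'n::finite ^ 'm::finite \<Rightarrow> complex ^ 'm ^ 'n" where
  "conj_transpose M = (\<chi> i j. cnj (M $ j $ i))"

text \<open>The slices of \<open>A\<^sup>H\<close> are the conjugate transposes of \<open>A\<^sup>(\<^sup>1\<^sup>)\<close>, \<open>A\<^sup>(\<^sup>p\<^sup>)\<close>, \<dots>, \<open>A\<^sup>(\<^sup>2\<^sup>)\<close>.\<close>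

definition tconj_transpose :: "('m::finite, 'n::finite, 'p::finite) tensor \<Rightarrow> ('n, 'm, 'p) tensor" where
  "tconj_transpose A = (\<chi> k. conj_transpose (A $ (- k)))"

definition tinner :: "('m::finite, 'n::finite, 'p::finite) tensor \<Rightarrow> ('m, 'n, 'p) tensor \<Rightarrow> complex" where
  "tinner A B = (\<Sum>i\<in>UNIV. \<Sum>j\<in>UNIV. \<Sum>k\<in>UNIV. cnj (A $ k $ i $ j) * B $ k $ i $ j)"

definition ttrace :: "('n::finite, 'n, 'p::finite) tensor \<Rightarrow> complex" where
  "ttrace A = trace (bcirc A)"

definition T_Hermitian :: "('n::finite, 'n, 'p::finite) tensor set" where
  "T_Hermitian = {A. tconj_transpose A = A}"

definition T_pos_def :: "('n::finite, 'n, 'p::finite) tensor set" where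
  "T_pos_def = {A \<in> T_Hermitian. \<forall>X :: ('n, 1, 'p) tensor. X \<noteq> 0 \<longrightarrow>
     tinner X (A \<star> X) \<in> \<real> \<and> 0 < Re (tinner X (A \<star> X))}"

text \<open>
  For \<open>P\<close> T-positive definite and \<open>X\<close>, \<open>Y\<close> T-Hermitian (the tangent vectors at \<open>P\<close>) the trace
  below is a real number; \<^const>\<open>Re\<close> only changes the type.
\<close>

definition riem_metric :: "('n::finite, 'n, 'p::finite) tensor \<Rightarrow>
    ('n, 'n, 'p) tensor \<Rightarrow> ('n, 'n, 'p) tensor \<Rightarrow> real" where
  "riem_metric P X Y = Re (ttrace (tinv P \<star> X \<star> tinv P \<star> Y))"

text \<open>Infinitely differentiable; one-sided derivatives at the end points if \<open>S\<close> is an interval.\<close>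

definition smooth_on :: "real set \<Rightarrow> (real \<Rightarrow> 'a::real_normed_vector) \<Rightarrow> bool" where
  "smooth_on S f \<longleftrightarrow> (\<exists>D :: nat \<Rightarrow> real \<Rightarrow> 'a. D 0 = f \<and>
     (\<forall>k. \<forall>t\<in>S. (D k has_vector_derivative D (Suc k) t) (at t within S)))"

text \<open>
  Continuity on the whole interval is implied, as the closed pieces overlap in the break points.
\<close>

definition piecewise_smooth_on :: "real \<Rightarrow> real \<Rightarrow> (real \<Rightarrow> 'a::real_normed_vector) \<Rightarrow> bool" where
  "piecewise_smooth_on a b f \<longleftrightarrow> (\<exists>(m::nat) (\<tau> :: nat \<Rightarrow> real). \<tau> 0 = a \<and> \<tau> m = b \<and>
     (\<forall>i<m. \<tau> i < \<tau> (Suc i) \<and> smooth_on {\<tau> i..\<tau> (Suc i)} f))"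

definition piecewise_smooth_path :: "real \<Rightarrow> real \<Rightarrow> (real \<Rightarrow> ('n::finite, 'n, 'p::finite) tensor) \<Rightarrow>
    ('n, 'n, 'p) tensor \<Rightarrow> ('n, 'n, 'p) tensor \<Rightarrow> bool" where
  "piecewise_smooth_path a b \<gamma> A B \<longleftrightarrow> a < b \<and> piecewise_smooth_on a b \<gamma> \<and>
     \<gamma> ` {a..b} \<subseteq> T_pos_def \<and> \<gamma> a = A \<and> \<gamma> b = B"

text \<open>The integrand is irrelevant at the finitely many points where \<open>\<gamma>\<close> has no derivative.\<close>

definition path_len :: "real \<Rightarrow> real \<Rightarrow> (real \<Rightarrow> ('n::finite, 'n, 'p::finite) tensor) \<Rightarrow> real" where
  "path_len a b \<gamma> = integral {a..b} (\<lambda>t. sqrt (riem_metric (\<gamma> t)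
     (vector_derivative \<gamma> (at t)) (vector_derivative \<gamma> (at t))))"

text \<open>
  The value 0 outside \<^const>\<open>T_pos_def\<close> is a convention: \<^const>\<open>Metric_space\<close> wants distances to be
  nonnegative and symmetric also outside the carrier.
\<close>

definition riem_dist :: "('n::finite, 'n, 'p::finite) tensor \<Rightarrow> ('n, 'n, 'p) tensor \<Rightarrow> real" where
  "riem_dist A B = (if A \<in> T_pos_def \<and> B \<in> T_pos_def
     then Inf {path_len a b \<gamma> |a b \<gamma>. piecewise_smooth_path a b \<gamma> A B} else 0)"

definition geodesic_segment :: "'a set \<Rightarrow> ('a \<Rightarrow> 'a \<Rightarrow> real) \<Rightarrow> 'a \<Rightarrow> 'a \<Rightarrow> 'a set \<Rightarrow> bool" where
  "geodesic_segment M d x y S \<longleftrightarrow> (\<exists>(l::real) c. 0 \<le> l \<and> c 0 = x \<and> c l = y \<and> S = c ` {0..l} \<and>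
     S \<subseteq> M \<and> (\<forall>s\<in>{0..l}. \<forall>t\<in>{0..l}. d (c s) (c t) = \<bar>s - t\<bar>))"

definition geodesic_space :: "'a set \<Rightarrow> ('a \<Rightarrow> 'a \<Rightarrow> real) \<Rightarrow> bool" where
  "geodesic_space M d \<longleftrightarrow> Metric_space M d \<and> (\<forall>x\<in>M. \<forall>y\<in>M. \<exists>S. geodesic_segment M d x y S)"

text \<open>
  \<open>x'\<close> in the Euclidean segment from \<open>a'\<close> to \<open>b'\<close> is a comparison point for \<open>x\<close> in the geodesic
  segment \<open>S\<close> issuing from \<open>a\<close>.
\<close>

definition comparison_point :: "('a \<Rightarrow> 'a \<Rightarrow> real) \<Rightarrow> 'a \<Rightarrow> 'a set \<Rightarrow> real ^ 2 \<Rightarrow> real ^ 2 \<Rightarrow>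
    'a \<Rightarrow> real ^ 2 \<Rightarrow> bool" where
  "comparison_point d a S a' b' x x' \<longleftrightarrow>
     x \<in> S \<and> x' \<in> closed_segment a' b' \<and> dist a' x' = d a x"

text \<open>
  Every geodesic triangle (vertices \<open>p, q, r\<close>, sides \<open>S, T, U\<close>) is at most as thick as its
  comparison triangle \<open>p', q', r'\<close> in the Euclidean plane, which exists and is unique up to isometry.
\<close>

definition CAT0_space :: "'a set \<Rightarrow> ('a \<Rightarrow> 'a \<Rightarrow> real) \<Rightarrow> bool" where
  "CAT0_space M d \<longleftrightarrow> geodesic_space M d \<and>
    (\<forall>p\<in>M. \<forall>q\<in>M. \<forall>r\<in>M. \<forall>S T U. \<forall>p' q' r' :: real ^ 2.
      geodesic_segment M d p q S \<longrightarrow> geodesic_segment M d q r T \<longrightarrow> geodesic_segment M d r p U \<longrightarrow>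
      dist p' q' = d p q \<longrightarrow> dist q' r' = d q r \<longrightarrow> dist r' p' = d r p \<longrightarrow>
      (let cmp = (\<lambda>x x'. comparison_point d p S p' q' x x' \<or>
                         comparison_point d q T q' r' x x' \<or>
                         comparison_point d r U r' p' x x')
       in \<forall>x x' y y'. cmp x x' \<longrightarrow> cmp y y' \<longrightarrow> d x y \<le> dist x' y'))"

end

theory Submission
  imports Defs
begin

text \<open>
  The block circulant representation identifies the tensors with a *-algebra of matrices whose real
  inner product is \<open>\<langle>A, B\<rangle> = Re tr (A\<^sup>H * B) / p\<close>.  A T-Hermitian tensor \<open>A\<close> acts by left multiplication as a symmetric
  operator on this Euclidean space; splitting the identity tensor into eigenvectors of that operator
  yields spectral projections inside the algebra (\<open>spectral_resolution\<close>) and with them a functional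
  calculus \<open>tfun f A\<close>; in particular exponentials and logarithms are available.

  Nonpositive curvature comes from one inequality: for T-positive definite \<open>P\<close> and \<open>Q\<close>
  \<open>\<parallel>log P - log Q\<parallel>\<^sup>2 \<le> \<langle>P - Q, Q\<^sup>-\<^sup>1 - P\<^sup>-\<^sup>1\<rangle> = \<langle>P - Q, Q\<^sup>-\<^sup>1 * (P - Q) * P\<^sup>-\<^sup>1\<rangle>\<close>
  (\<open>tlog_diff_le\<close>).  Expanded in the spectral projections of \<open>P\<close> and \<open>Q\<close> it reduces to an inequality
  between real numbers.  Along a path the right-hand side is asymptotically \<open>1/p\<close> times the squared
  Riemannian length of the increment, so that a path from \<open>P\<close> to \<open>Q\<close> is at least as long as
  \<open>\<surd>p \<parallel>log P - log Q\<parallel>\<close> (\<open>piecewise_smooth_path_length\<close>): the logarithm maps the cone without increasing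
  distances to the flat space of T-Hermitian tensors.  The curves \<open>t \<mapsto> exp (t X)\<close> attain this bound, and
  distances to the identity tensor are preserved.

  The congruences \<open>A \<mapsto> G * A * G\<^sup>H\<close> are isometries and act transitively.  Given a geodesic from \<open>A\<close> to
  \<open>B\<close>, a point \<open>M\<close> on it and a third point \<open>C\<close>, one may therefore assume that \<open>M\<close> is the identity
  tensor.  Passing to logarithms then keeps the distances from \<open>M\<close> and the distance of \<open>A\<close> and \<open>B\<close>, and
  does not increase the distances from \<open>C\<close> to \<open>A\<close> and \<open>B\<close>.  Stewart's theorem in the flat space thus
  becomes an inequality in the cone (\<open>riem_dist_Stewart\<close>), which in any metric space implies that
  geodesics are unique and that triangles are thin (\<open>CAT0_space_of_Stewart\<close>).
\<close>

section \<open>The *-algebra of tensors\<close>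

abbreviation adjoint_tensor :: "('m::finite, 'n::finite, 'p::finite) tensor \<Rightarrow> ('n, 'm, 'p) tensor"
    (\<open>(_\<^sup>H)\<close> [1000] 1000) where
  "A\<^sup>H \<equiv> tconj_transpose A"

lemma bcirc_inject: "bcirc A = bcirc B \<longleftrightarrow> A = B"
proof
  assume eq: "bcirc A = bcirc B"
  have "A $ k $ i $ j = B $ k $ i $ j" for k i j
  proof -
    have "A $ k $ i $ j = bcirc A $ (k, i) $ (0, j)"
      by (simp add: bcirc_def)
    also have "\<dots> = B $ k $ i $ j"
      unfolding eq by (simp add: bcirc_def)
    finally show ?thesis .
  qed
  then show "A = B"
    by (simp add: vec_eq_iff)
qed simp

lemma sum_UNIV_pairs:
  fixes f :: "'a::finite \<Rightarrow> 'b::finite \<Rightarrow> 'c::comm_monoid_add"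
  shows "(\<Sum>c\<in>UNIV. f (fst c) (snd c)) = (\<Sum>a\<in>UNIV. \<Sum>b\<in>UNIV. f a b)"
  unfolding sum.cartesian_product UNIV_Times_UNIV by (rule sum.cong) (auto simp: split_def)

lemma tprod_nth:
  "(A \<star> B) $ k $ i $ j = (\<Sum>l\<in>UNIV. \<Sum>m\<in>UNIV. A $ (k - l) $ i $ m * B $ l $ m $ j)"
  using sum_UNIV_pairs[of "\<lambda>l m. A $ (k - l) $ i $ m * B $ l $ m $ j"]
  by (simp add: tprod_def tfold_def bcirc_def tunfold_def matrix_matrix_mult_def)

text \<open>
  Block circulant matrices multiply by convolution of their first block columns, and the T-product
  is that convolution.  All algebraic laws of the T-product are therefore those of matrices.
\<close>

lemma bcirc_tprod: "bcirc (A \<star> B) = bcirc A ** bcirc B"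
proof -
  have "bcirc (A \<star> B) $ r $ c = (bcirc A ** bcirc B) $ r $ c" for r c
  proof -
    obtain a i b j where rc: "r = (a, i)" "c = (b, j)"
      by fastforce
    have "bcirc (A \<star> B) $ r $ c = (\<Sum>l\<in>UNIV. \<Sum>m\<in>UNIV. A $ (a - b - l) $ i $ m * B $ l $ m $ j)"
      by (simp add: rc bcirc_def tprod_nth)
    also have "\<dots> = (\<Sum>l\<in>UNIV. \<Sum>m\<in>UNIV. A $ (a - l) $ i $ m * B $ (l - b) $ m $ j)"
      by (rule sum.reindex_bij_witness[of _ "\<lambda>l. l - b" "\<lambda>l. l + b"]) (simp_all add: algebra_simps)
    also have "\<dots> = (bcirc A ** bcirc B) $ r $ c"
      unfolding sum_UNIV_pairs[symmetric] by (simp add: rc bcirc_def matrix_matrix_mult_def)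
    finally show ?thesis .
  qed
  then show ?thesis
    by (simp add: vec_eq_iff)
qed

lemma bcirc_tident: "bcirc tident = mat 1"
  by (auto simp: vec_eq_iff bcirc_def tident_def mat_def)

lemma bcirc_tadjoint: "bcirc A\<^sup>H = conj_transpose (bcirc A)"
  by (simp add: vec_eq_iff bcirc_def tconj_transpose_def conj_transpose_def)

lemma conj_transpose_mult: "conj_transpose (M ** N) = conj_transpose N ** conj_transpose M"
  by (simp add: vec_eq_iff conj_transpose_def matrix_matrix_mult_def mult.commute)

lemma tprod_assoc: "(A \<star> B) \<star> C = A \<star> (B \<star> C)"
  by (simp flip: bcirc_inject add: bcirc_tprod matrix_mul_assoc)

lemma tprod_tident_left [simp]: "tident \<star> A = A"
  by (simp flip: bcirc_inject add: bcirc_tprod bcirc_tident)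

lemma tprod_tident_right [simp]: "A \<star> tident = A"
  by (simp flip: bcirc_inject add: bcirc_tprod bcirc_tident)

lemma tadjoint_tprod: "(A \<star> B)\<^sup>H = B\<^sup>H \<star> A\<^sup>H"
  by (simp flip: bcirc_inject add: bcirc_tprod bcirc_tadjoint conj_transpose_mult)

lemma tadjoint_adjoint [simp]: "A\<^sup>H\<^sup>H = A"
  by (simp add: vec_eq_iff tconj_transpose_def conj_transpose_def)

lemma tadjoint_tident [simp]: "tident\<^sup>H = tident"
  by (auto simp: vec_eq_iff tconj_transpose_def conj_transpose_def tident_def mat_def)

lemma linear_tadjoint: "linear (tconj_transpose :: ('m::finite, 'n::finite, 'p::finite) tensor \<Rightarrow> _)"
  by (rule linearI) (simp_all add: vec_eq_iff tconj_transpose_def conj_transpose_def)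

lemma bounded_bilinear_tprod:
  "bounded_bilinear (tprod :: ('m::finite, 'n::finite, 'p::finite) tensor \<Rightarrow> ('n, 'l::finite, 'p) tensor \<Rightarrow> _)"
proof -
  have "bilinear (tprod :: ('m, 'n, 'p) tensor \<Rightarrow> ('n, 'l, 'p) tensor \<Rightarrow> _)"
    unfolding bilinear_def
    by (auto intro!: linearI simp: vec_eq_iff tprod_nth algebra_simps sum.distrib scaleR_sum_right)
  then show ?thesis
    by (simp add: bilinear_conv_bounded_bilinear)
qed

interpretation tprod: bounded_bilinear tprod
  by (rule bounded_bilinear_tprod)

lemma tinner_cmod: "tinner X X = of_real ((norm X)\<^sup>2)"
proof -
  have "(norm X)\<^sup>2 = (\<Sum>k\<in>UNIV. \<Sum>i\<in>UNIV. \<Sum>j\<in>UNIV. (cmod (X $ k $ i $ j))\<^sup>2)"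
    by (simp add: norm_vec_def L2_set_def sum_nonneg)
  also have "\<dots> = (\<Sum>i\<in>UNIV. \<Sum>k\<in>UNIV. \<Sum>j\<in>UNIV. (cmod (X $ k $ i $ j))\<^sup>2)"
    by (rule sum.swap)
  also have "\<dots> = (\<Sum>i\<in>UNIV. \<Sum>j\<in>UNIV. \<Sum>k\<in>UNIV. (cmod (X $ k $ i $ j))\<^sup>2)"
    by (intro sum.cong sum.swap refl)
  finally show ?thesis
    by (simp add: tinner_def mult.commute flip: complex_norm_square of_real_power of_real_sum)
qed

lemma Re_tinner: "Re (tinner X Y) = X \<bullet> Y"
proof -
  have "X \<bullet> Y = (\<Sum>k\<in>UNIV. \<Sum>i\<in>UNIV. \<Sum>j\<in>UNIV. Re (cnj (X $ k $ i $ j) * Y $ k $ i $ j))"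
    by (simp add: inner_vec_def inner_complex_def)
  also have "\<dots> = (\<Sum>i\<in>UNIV. \<Sum>k\<in>UNIV. \<Sum>j\<in>UNIV. Re (cnj (X $ k $ i $ j) * Y $ k $ i $ j))"
    by (rule sum.swap)
  also have "\<dots> = (\<Sum>i\<in>UNIV. \<Sum>j\<in>UNIV. \<Sum>k\<in>UNIV. Re (cnj (X $ k $ i $ j) * Y $ k $ i $ j))"
    by (intro sum.cong sum.swap refl)
  finally show ?thesis
    by (simp add: tinner_def)
qed

text \<open>
  The Hermitian product is the trace of one diagonal block of \<open>bcirc (X\<^sup>H \<star> Y)\<close>.  The diagonal
  blocks being equal, \<^const>\<open>ttrace\<close> is \<open>p\<close> times that trace; hence the factors \<open>p\<close> below.
\<close>

lemma tinner_altdef: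
  "tinner X Y = (\<Sum>j\<in>UNIV. (X\<^sup>H \<star> Y) $ 0 $ j $ j)"
proof -
  have "(\<Sum>j\<in>UNIV. (X\<^sup>H \<star> Y) $ 0 $ j $ j)
      = (\<Sum>j\<in>UNIV. \<Sum>k\<in>UNIV. \<Sum>i\<in>UNIV. cnj (X $ k $ i $ j) * Y $ k $ i $ j)"
    by (simp add: tprod_nth tconj_transpose_def conj_transpose_def)
  also have "\<dots> = (\<Sum>j\<in>UNIV. \<Sum>i\<in>UNIV. \<Sum>k\<in>UNIV. cnj (X $ k $ i $ j) * Y $ k $ i $ j)"
    by (intro sum.cong sum.swap refl)
  also have "\<dots> = tinner X Y"
    unfolding tinner_def by (rule sum.swap)
  finally show ?thesis ..
qed

lemma tinner_tprod_left: "tinner (A \<star> X) Y = tinner X (A\<^sup>H \<star> Y)"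
  by (simp add: tinner_altdef tadjoint_tprod tprod_assoc)

lemma ttrace_altdef:
  "ttrace (A :: ('n::finite, 'n, 'p::finite) tensor) = of_nat CARD('p mod_ring) * (\<Sum>i\<in>UNIV. A $ 0 $ i $ i)"
proof -
  have "ttrace A = (\<Sum>c\<in>(UNIV \<times> UNIV :: ('p mod_ring \<times> 'n) set). A $ 0 $ snd c $ snd c)"
    by (simp add: ttrace_def trace_def bcirc_def)
  also have "\<dots> = (\<Sum>k\<in>(UNIV::'p mod_ring set). \<Sum>i\<in>UNIV. A $ 0 $ i $ i)"
    using sum_UNIV_pairs[of "\<lambda>(k::'p mod_ring) i. A $ 0 $ i $ i"] by simp
  finally show ?thesis by simp
qed

lemma ttrace_tprod_commute: "ttrace (A \<star> B) = ttrace (B \<star> A)"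
  for A B :: "('n::finite, 'n, 'p::finite) tensor"
  unfolding ttrace_def bcirc_tprod by (rule trace_mul_sym)

lemma Re_ttrace_tprod:
  "Re (ttrace (A \<star> B)) = real CARD('p) * (A\<^sup>H \<bullet> B)"
  for A B :: "('n::finite, 'n, 'p::finite) tensor"
  unfolding Re_tinner[symmetric] by (simp add: ttrace_altdef tinner_altdef)

lemma inner_tprod_left: "(A \<star> X) \<bullet> Y = X \<bullet> (A\<^sup>H \<star> Y)"
  using tinner_tprod_left[of A X Y] unfolding Re_tinner[symmetric] by (rule arg_cong)

lemma inner_tprod_right: "(X \<star> A) \<bullet> Y = X \<bullet> (Y \<star> A\<^sup>H)"
  for A X Y :: "('n::finite, 'n, 'p::finite) tensor"
proof -
  have "real CARD('p) * ((X \<star> A) \<bullet> Y) = Re (ttrace (A\<^sup>H \<star> (X\<^sup>H \<star> Y)))"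
    using Re_ttrace_tprod[of "(X \<star> A)\<^sup>H" Y] by (simp add: tadjoint_tprod tprod_assoc)
  also have "\<dots> = Re (ttrace (X\<^sup>H \<star> (Y \<star> A\<^sup>H)))"
    by (subst ttrace_tprod_commute) (simp add: tprod_assoc)
  also have "\<dots> = real CARD('p) * (X \<bullet> (Y \<star> A\<^sup>H))"
    by (simp add: Re_ttrace_tprod)
  finally show ?thesis by simp
qed

lemma tinv_unique:
  assumes "A \<star> B = tident" "B \<star> A = tident"
  shows "tinv A = B"
  unfolding tinv_def
proof (rule the_equality)
  show "A \<star> B = tident \<and> B \<star> A = tident"
    using assms by simp
  fix C assume "A \<star> C = tident \<and> C \<star> A = tident"
  then show "C = B"
    by (metis assms(2) tprod_assoc tprod_tident_left tprod_tident_right)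
qed

lemma T_Hermitian_iff: "A \<in> T_Hermitian \<longleftrightarrow> A\<^sup>H = A"
  by (simp add: T_Hermitian_def)

section \<open>Diagonalisation of symmetric operators\<close>

text \<open>
  A unit vector at which the quadratic form of \<open>f\<close> is maximal on an invariant subspace \<open>U\<close> is an
  eigenvector: with \<open>M\<close> the maximum, the form of \<open>M - f\<close> is nonnegative on \<open>U\<close> and vanishes at
  that vector, so that its gradient \<open>2 (M x - f x)\<close> vanishes there too.
\<close>

lemma symmetric_eigenvector_exists:
  fixes f :: "'a::euclidean_space \<Rightarrow> 'a"
  assumes "linear f" and sym: "\<And>x y. f x \<bullet> y = x \<bullet> f y"
    and U: "subspace U" "f ` U \<subseteq> U" "U \<noteq> {0}"
  obtains x c where "x \<in> U" "x \<noteq> 0" "f x = c *\<^sub>R x"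
proof -
  interpret f: linear f by fact
  define S where "S = U \<inter> sphere 0 1"
  obtain u where u: "u \<in> U" "u \<noteq> 0"
    using U(1,3) subspace_0 by blast
  have "compact S"
    unfolding S_def using closed_subspace[OF U(1)] by (simp add: closed_Int_compact)
  moreover have "inverse (norm u) *\<^sub>R u \<in> S"
    using u U(1) by (simp add: S_def subspace_scale)
  moreover have "continuous_on S (\<lambda>x. x \<bullet> f x)"
    using \<open>linear f\<close> by (intro continuous_intros linear_continuous_on linear_conv_bounded_linear[THEN iffD1])
  ultimately obtain x where x: "x \<in> S" and max: "\<And>y. y \<in> S \<Longrightarrow> y \<bullet> f y \<le> x \<bullet> f x"
    using continuous_attains_sup[of S "\<lambda>x. x \<bullet> f x"] by blast
  define M where "M = x \<bullet> f x"
  define z where "z = M *\<^sub>R x - f x"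
  have xU: "x \<in> U" and x1: "x \<bullet> x = 1"
    using x by (auto simp: S_def dot_square_norm)
  have bound: "y \<bullet> f y \<le> M * (y \<bullet> y)" if "y \<in> U" for y
  proof (cases "y = 0")
    case False
    have "inverse (norm y) *\<^sub>R y \<in> S"
      using that U(1) False by (simp add: S_def subspace_scale)
    from max[OF this] have "inverse (norm y) * (inverse (norm y) * (y \<bullet> f y)) \<le> M"
      by (simp add: f.scaleR M_def)
    then have "(y \<bullet> f y) / (norm y)\<^sup>2 \<le> M"
      by (simp add: divide_inverse power2_eq_square ac_simps)
    then show ?thesis
      using False by (simp add: divide_le_eq dot_square_norm)
  qed (simp add: f.zero)
  have zU: "z \<in> U"
    unfolding z_def using xU U by (auto intro!: subspace_diff subspace_scale)
  have "0 \<le> - 2 * e * (z \<bullet> z) + e\<^sup>2 * (M * (z \<bullet> z) - z \<bullet> f z)" for e :: real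
  proof -
    have "0 \<le> M * ((x - e *\<^sub>R z) \<bullet> (x - e *\<^sub>R z)) - (x - e *\<^sub>R z) \<bullet> f (x - e *\<^sub>R z)"
      using bound[of "x - e *\<^sub>R z"] xU zU U(1) by (simp add: subspace_diff subspace_scale)
    also have "\<dots> = (M * (x \<bullet> x) - x \<bullet> f x) - 2 * e * ((M *\<^sub>R x - f x) \<bullet> z)
        + e\<^sup>2 * (M * (z \<bullet> z) - z \<bullet> f z)"
      using sym[of z x] sym[of x z]
      by (simp add: f.diff f.scaleR algebra_simps inner_commute power2_eq_square)
    also have "\<dots> = - 2 * e * (z \<bullet> z) + e\<^sup>2 * (M * (z \<bullet> z) - z \<bullet> f z)"
      using x1 by (simp add: M_def z_def)
    finally show ?thesis .
  qed
  note quad = this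
  have "z \<bullet> z \<le> 0"
  proof (rule ccontr)
    assume "\<not> z \<bullet> z \<le> 0"
    \<comment> \<open>The quadratic polynomial \<open>- 2 e a + e\<^sup>2 b\<close> is smallest at \<open>e = a / b\<close>; the summand 1 makes \<open>b\<close> positive.\<close>
    define a where "a = z \<bullet> z"
    define b where "b = \<bar>M * (z \<bullet> z) - z \<bullet> f z\<bar> + 1"
    have "a > 0" "b > 0" and le: "M * (z \<bullet> z) - z \<bullet> f z \<le> b"
      using \<open>\<not> z \<bullet> z \<le> 0\<close> by (auto simp: a_def b_def)
    have "0 \<le> - 2 * (a / b) * a + (a / b)\<^sup>2 * b"
      using quad[of "a / b"] mult_left_mono[OF le, of "(a / b)\<^sup>2"] by (simp add: a_def)
    also have "\<dots> = - (a\<^sup>2 / b)"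
      using \<open>b > 0\<close> by (simp add: power2_eq_square field_simps)
    finally show False
      using \<open>a > 0\<close> \<open>b > 0\<close> by (simp add: field_simps)
  qed
  then have "z = 0"
    using inner_gt_zero_iff[of z] by linarith
  then have "f x = M *\<^sub>R x"
    by (simp add: z_def)
  with that xU x1 show thesis by force
qed

text \<open>
  The orthogonal complement of all eigenvectors is invariant and contains no eigenvector, so it is
  trivial.
\<close>

lemma symmetric_span_eigenvectors:
  fixes f :: "'a::euclidean_space \<Rightarrow> 'a"
  assumes "linear f" and sym: "\<And>x y. f x \<bullet> y = x \<bullet> f y"
  shows "span {x. \<exists>c. f x = c *\<^sub>R x} = UNIV"
proof (rule ccontr)
  interpret f: linear f by fact
  define E where "E = {x. \<exists>c. f x = c *\<^sub>R x}"
  define U where "U = {x. \<forall>y\<in>E. y \<bullet> x = 0}"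
  assume "\<not> span {x. \<exists>c. f x = c *\<^sub>R x} = UNIV"
  then have "dim E < DIM('a)"
    unfolding E_def[symmetric] using dim_eq_full[of E] dim_subset_UNIV[of E] by simp
  then obtain x where x: "x \<noteq> 0" "\<And>y. y \<in> span E \<Longrightarrow> orthogonal x y"
    using orthogonal_to_subspace_exists by metis
  have "x \<in> U"
    unfolding U_def
  proof (rule CollectI, rule ballI)
    fix y assume "y \<in> E"
    from x(2)[OF span_base[OF this]] show "y \<bullet> x = 0"
      by (simp add: orthogonal_def inner_commute)
  qed
  have "subspace U"
    by (auto simp: U_def subspace_def inner_right_distrib)
  moreover have "f ` U \<subseteq> U"
  proof clarify
    fix x assume "x \<in> U"
    show "f x \<in> U"
      unfolding U_def
    proof (rule CollectI, rule ballI)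
      fix y assume "y \<in> E"
      then obtain c where "f y = c *\<^sub>R y"
        by (auto simp: E_def)
      then have "y \<bullet> f x = c * (y \<bullet> x)"
        using sym[of y x] by simp
      then show "y \<bullet> f x = 0"
        using \<open>x \<in> U\<close> \<open>y \<in> E\<close> by (simp add: U_def)
    qed
  qed
  moreover have "U \<noteq> {0}"
    using \<open>x \<in> U\<close> x(1) by blast
  ultimately obtain v c where v: "v \<in> U" "v \<noteq> 0" "f v = c *\<^sub>R v"
    by (rule symmetric_eigenvector_exists[OF \<open>linear f\<close> sym])
  then have "v \<in> E"
    unfolding E_def by blast
  with v(1) have "v \<bullet> v = 0"
    unfolding U_def by blast
  with v(2) show False
    by simp
qed

text \<open>
  The summands are indexed by the eigenvalues: eigenvectors that belong to the same eigenvalue have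
  been added up.
\<close>

lemma symmetric_eigenvector_decomposition:
  fixes f :: "'a::euclidean_space \<Rightarrow> 'a"
  assumes "linear f" and sym: "\<And>x y. f x \<bullet> y = x \<bullet> f y"
  obtains S E where "finite S" "\<And>s. f (E s) = s *\<^sub>R E s" "(\<Sum>s\<in>S. E s) = x"
proof -
  interpret f: linear f by fact
  define D where "D = {x. \<exists>S E. finite S \<and> (\<forall>s. f (E s) = s *\<^sub>R E s) \<and> (\<Sum>s\<in>S. E s) = x}"
  have "subspace D"
    unfolding subspace_def
  proof (intro conjI ballI allI)
    show "0 \<in> D"
      unfolding D_def by (rule CollectI, rule exI[of _ "{}"], rule exI[of _ "\<lambda>_. 0"]) (simp add: f.zero)
  next
    fix x y assume "x \<in> D" "y \<in> D"
    then obtain S E T F where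
      S: "finite S" "\<And>s. f (E s) = s *\<^sub>R E s" "(\<Sum>s\<in>S. E s) = x" and
      T: "finite T" "\<And>s. f (F s) = s *\<^sub>R F s" "(\<Sum>s\<in>T. F s) = y"
      unfolding D_def by blast
    define G where "G s = (if s \<in> S then E s else 0) + (if s \<in> T then F s else 0)" for s
    have "sum G (S \<union> T) = (\<Sum>s\<in>S\<union>T. if s \<in> S then E s else 0) + (\<Sum>s\<in>S\<union>T. if s \<in> T then F s else 0)"
      by (simp add: G_def sum.distrib)
    also have "(\<Sum>s\<in>S\<union>T. if s \<in> S then E s else 0) = x"
      unfolding S(3)[symmetric] by (rule sum.mono_neutral_cong_right) (use S(1) T(1) in auto)
    also have "(\<Sum>s\<in>S\<union>T. if s \<in> T then F s else 0) = y"
      unfolding T(3)[symmetric] by (rule sum.mono_neutral_cong_right) (use S(1) T(1) in auto)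
    finally have "sum G (S \<union> T) = x + y" .
    moreover have "f (G s) = s *\<^sub>R G s" for s
      by (simp add: G_def f.add f.zero S(2) T(2) scaleR_add_right)
    ultimately show "x + y \<in> D"
      unfolding D_def using S(1) T(1) by (intro CollectI exI[of _ "S \<union> T"] exI[of _ G]) simp
  next
    fix c x assume "x \<in> D"
    then obtain S E where
      S: "finite S" "\<And>s. f (E s) = s *\<^sub>R E s" "(\<Sum>s\<in>S. E s) = x"
      unfolding D_def by blast
    show "c *\<^sub>R x \<in> D"
      unfolding D_def using S(1)
      by (intro CollectI exI[of _ S] exI[of _ "\<lambda>s. c *\<^sub>R E s"])
        (simp add: f.scaleR S(2) scaleR_sum_right flip: S(3))
  qed
  moreover have "{x. \<exists>c. f x = c *\<^sub>R x} \<subseteq> D"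
  proof clarify
    fix x c assume "f x = c *\<^sub>R x"
    then show "x \<in> D"
      unfolding D_def
      by (intro CollectI exI[of _ "{c}"] exI[of _ "\<lambda>s. if s = c then x else 0"]) (simp add: f.zero)
  qed
  ultimately have "x \<in> D"
    using span_minimal symmetric_span_eigenvectors[OF assms] by blast
  then obtain S E where "finite S" "\<And>s. f (E s) = s *\<^sub>R E s" "(\<Sum>s\<in>S. E s) = x"
    unfolding D_def by auto
  then show thesis
    by (rule that)
qed

section \<open>Functional calculus for T-Hermitian tensors\<close>

text \<open>A resolution of the identity into orthogonal projections, some of which may vanish.\<close>

definition resolution :: "real set \<Rightarrow> (real \<Rightarrow> ('n::finite, 'n, 'p::finite) tensor) \<Rightarrow> bool" where
  "resolution S E \<longleftrightarrow> finite S \<and> (\<forall>s\<in>S. (E s)\<^sup>H = E s) \<and>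
     (\<forall>s\<in>S. \<forall>t\<in>S. E s \<star> E t = (if s = t then E s else 0)) \<and> (\<Sum>s\<in>S. E s) = tident"

text \<open>
  Write the identity tensor as a sum of eigenvectors \<open>E s\<close> of left multiplication by \<open>A\<close>.  Comparing
  the two ways to evaluate \<open>E\<^sub>s\<^sup>H * A * E\<^sub>t\<close> gives \<open>E\<^sub>s\<^sup>H * E\<^sub>t = 0\<close> for \<open>s \<noteq> t\<close>, whence
  \<open>E\<^sub>t = (\<Sum>\<^sub>s E\<^sub>s)\<^sup>H * E\<^sub>t = E\<^sub>t\<^sup>H * E\<^sub>t\<close>: the eigenvectors are Hermitian idempotents of their own accord.
\<close>

lemma spectral_resolution:
  fixes A :: "('n::finite, 'n, 'p::finite) tensor"
  assumes "A\<^sup>H = A"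
  obtains S E where "resolution S E" "A = (\<Sum>s\<in>S. s *\<^sub>R E s)" "\<And>s. A \<star> E s = s *\<^sub>R E s"
proof -
  obtain S E where S: "finite S" "\<And>s. A \<star> E s = s *\<^sub>R E s" "(\<Sum>s\<in>S. E s) = tident"
    using symmetric_eigenvector_decomposition[of "\<lambda>X. A \<star> X" tident] assms
      inner_tprod_left[of A] tprod.bounded_linear_right[of A] bounded_linear.linear
    by metis
  have lin: "linear (tconj_transpose :: ('n, 'n, 'p) tensor \<Rightarrow> _)"
    by (rule linear_tadjoint)
  have orth: "(E s)\<^sup>H \<star> E t = 0" if "s \<noteq> t" for s t
  proof -
    have "t *\<^sub>R ((E s)\<^sup>H \<star> E t) = (E s)\<^sup>H \<star> (A \<star> E t)"
      by (simp add: S(2) tprod.scaleR_right)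
    also have "\<dots> = (A \<star> E s)\<^sup>H \<star> E t"
      by (simp add: tadjoint_tprod assms tprod_assoc)
    also have "\<dots> = s *\<^sub>R ((E s)\<^sup>H \<star> E t)"
      by (simp add: S(2) linear_scale[OF lin] tprod.scaleR_left)
    finally show ?thesis
      using that by simp
  qed
  have square: "(E t)\<^sup>H \<star> E t = E t" if "t \<in> S" for t
  proof -
    have "E t = tident\<^sup>H \<star> E t"
      by simp
    also have "\<dots> = (\<Sum>s\<in>S. (E s)\<^sup>H) \<star> E t"
      by (simp only: S(3)[symmetric] linear_sum[OF lin])
    also have "\<dots> = (\<Sum>s\<in>S. if s = t then (E t)\<^sup>H \<star> E t else 0)"
      unfolding tprod.sum_left by (rule sum.cong) (auto simp: orth)
    also have "\<dots> = (E t)\<^sup>H \<star> E t"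
      using S(1) that by simp
    finally show ?thesis ..
  qed
  have herm: "(E t)\<^sup>H = E t" if "t \<in> S" for t
  proof -
    have "(E t)\<^sup>H = ((E t)\<^sup>H \<star> E t)\<^sup>H"
      using square[OF that] by simp
    also have "\<dots> = (E t)\<^sup>H \<star> E t"
      by (simp only: tadjoint_tprod tadjoint_adjoint)
    finally show ?thesis
      using square[OF that] by simp
  qed
  have "resolution S E"
    unfolding resolution_def using S(1,3) herm orth square by metis
  moreover have "A = (\<Sum>s\<in>S. s *\<^sub>R E s)"
  proof -
    have "A = A \<star> (\<Sum>s\<in>S. E s)"
      by (simp add: S(3))
    then show ?thesis
      by (simp add: tprod.sum_right S(2))
  qed
  ultimately show thesis
    using that S(2) by blast
qed

text \<open>
  The weights \<open>\<parallel>E\<^sub>s * F\<^sub>t\<parallel>\<^sup>2\<close> are a joint distribution of the spectra of two tensors, which need not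
  commute: the products \<open>E\<^sub>s * F\<^sub>t\<close> are pairwise orthogonal and add up to the identity tensor.  It
  reduces inequalities between functions of two tensors to inequalities between numbers.
\<close>

lemma inner_two_resolutions:
  fixes E F :: "real \<Rightarrow> ('n::finite, 'n, 'p::finite) tensor"
  assumes E: "resolution S E" and F: "resolution T F"
  shows "((\<Sum>s\<in>S. f s *\<^sub>R E s) - (\<Sum>t\<in>T. g t *\<^sub>R F t)) \<bullet> ((\<Sum>s\<in>S. h s *\<^sub>R E s) - (\<Sum>t\<in>T. k t *\<^sub>R F t))
    = (\<Sum>s\<in>S. \<Sum>t\<in>T. (f s - g t) * (h s - k t) * (norm (E s \<star> F t))\<^sup>2)"
proof -
  have fin: "finite S" "finite T"
    using E F by (simp_all add: resolution_def)
  have left: "E s = (\<Sum>t\<in>T. E s \<star> F t)" for s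
    using F by (simp add: resolution_def flip: tprod.sum_right)
  have right: "F t = (\<Sum>s\<in>S. E s \<star> F t)" for t
    using E by (simp add: resolution_def flip: tprod.sum_left)
  have expand: "(\<Sum>s\<in>S. f s *\<^sub>R E s) - (\<Sum>t\<in>T. g t *\<^sub>R F t) = (\<Sum>s\<in>S. \<Sum>t\<in>T. (f s - g t) *\<^sub>R (E s \<star> F t))"
    for f g :: "real \<Rightarrow> real"
  proof -
    have "(\<Sum>s\<in>S. f s *\<^sub>R E s) = (\<Sum>s\<in>S. \<Sum>t\<in>T. f s *\<^sub>R (E s \<star> F t))"
      by (subst left) (simp add: scaleR_sum_right)
    moreover have "(\<Sum>t\<in>T. g t *\<^sub>R F t) = (\<Sum>s\<in>S. \<Sum>t\<in>T. g t *\<^sub>R (E s \<star> F t))"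
      by (subst right, subst sum.swap) (simp add: scaleR_sum_right)
    ultimately show ?thesis
      by (simp add: scaleR_diff_left sum_subtractf)
  qed
  have orth: "(E s \<star> F t) \<bullet> (E s' \<star> F t') = (if s = s' \<and> t = t' then (norm (E s \<star> F t))\<^sup>2 else 0)"
    if "s \<in> S" "s' \<in> S" "t \<in> T" "t' \<in> T" for s s' t t'
  proof (cases "s = s' \<and> t = t'")
    case True
    then show ?thesis by (simp add: dot_square_norm)
  next
    case False
    have "(E s \<star> F t) \<bullet> (E s' \<star> F t') = F t \<bullet> ((E s \<star> E s') \<star> F t')"
      using E that by (simp add: inner_tprod_left resolution_def flip: tprod_assoc)
    moreover have "(E s \<star> F t) \<bullet> (E s' \<star> F t') = E s \<bullet> (E s' \<star> (F t' \<star> F t))"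
      using F that by (simp add: inner_tprod_right resolution_def tprod_assoc)
    ultimately show ?thesis
      using False E F that by (auto simp: resolution_def tprod.zero_left tprod.zero_right)
  qed
  have "(\<Sum>s\<in>S. \<Sum>t\<in>T. (f s - g t) *\<^sub>R (E s \<star> F t)) \<bullet> (\<Sum>s\<in>S. \<Sum>t\<in>T. (h s - k t) *\<^sub>R (E s \<star> F t))
      = (\<Sum>s\<in>S. \<Sum>t\<in>T. \<Sum>s'\<in>S. \<Sum>t'\<in>T. (f s - g t) * ((h s' - k t') * ((E s \<star> F t) \<bullet> (E s' \<star> F t'))))"
    unfolding inner_sum_left unfolding inner_sum_right inner_scaleR_left inner_scaleR_right
    by (simp only: mult.left_commute)
  also have "\<dots> = (\<Sum>s\<in>S. \<Sum>t\<in>T. \<Sum>s'\<in>S. \<Sum>t'\<in>T.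
      if t' = t then if s' = s then (f s - g t) * (h s - k t) * (norm (E s \<star> F t))\<^sup>2 else 0 else 0)"
    by (intro sum.cong refl) (auto simp: orth)
  also have "\<dots> = (\<Sum>s\<in>S. \<Sum>t\<in>T. (f s - g t) * (h s - k t) * (norm (E s \<star> F t))\<^sup>2)"
    using fin by (intro sum.cong refl) simp
  finally show ?thesis
    by (simp only: expand)
qed

definition tfun :: "(real \<Rightarrow> real) \<Rightarrow> ('n::finite, 'n, 'p::finite) tensor \<Rightarrow> ('n, 'n, 'p) tensor" where
  "tfun f A = (SOME B. \<exists>S E. resolution S E \<and> A = (\<Sum>s\<in>S. s *\<^sub>R E s) \<and> B = (\<Sum>s\<in>S. f s *\<^sub>R E s))"

text \<open>
  The functional calculus does not depend on the resolution, and the coefficients of the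
  resolution need not be distinct: if \<open>\<Sum>\<^sub>s x\<^sub>s E\<^sub>s = \<Sum>\<^sub>t t F\<^sub>t\<close>, then the weight of \<open>(s, t)\<close> vanishes
  whenever \<open>x\<^sub>s \<noteq> t\<close>, so that \<open>\<Sum>\<^sub>s f x\<^sub>s E\<^sub>s\<close> and \<open>\<Sum>\<^sub>t f t F\<^sub>t\<close> have distance 0.
\<close>

lemma tfun_resolution:
  fixes E :: "real \<Rightarrow> ('n::finite, 'n, 'p::finite) tensor"
  assumes "resolution S E"
  shows "tfun f (\<Sum>s\<in>S. x s *\<^sub>R E s) = (\<Sum>s\<in>S. f (x s) *\<^sub>R E s)"
proof -
  define A where "A = (\<Sum>s\<in>S. x s *\<^sub>R E s)"
  have lin: "linear (tconj_transpose :: ('n, 'n, 'p) tensor \<Rightarrow> _)"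
    by (rule linear_tadjoint)
  have "A\<^sup>H = A"
    unfolding A_def using assms by (simp add: resolution_def linear_sum[OF lin] linear_scale[OF lin])
  then have "\<exists>B S E. resolution S E \<and> A = (\<Sum>s\<in>S. s *\<^sub>R E s) \<and> B = (\<Sum>s\<in>S. f s *\<^sub>R E s)"
    using spectral_resolution[of A] by metis
  then have "\<exists>S E. resolution S E \<and> A = (\<Sum>s\<in>S. s *\<^sub>R E s) \<and> tfun f A = (\<Sum>s\<in>S. f s *\<^sub>R E s)"
    unfolding tfun_def by (rule someI_ex)
  then obtain T F where F: "resolution T F" "A = (\<Sum>t\<in>T. t *\<^sub>R F t)" "tfun f A = (\<Sum>t\<in>T. f t *\<^sub>R F t)"
    by blast
  have fin: "finite S" "finite T"
    using assms F by (simp_all add: resolution_def)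
  have "(\<Sum>s\<in>S. \<Sum>t\<in>T. (x s - t) * (x s - t) * (norm (E s \<star> F t))\<^sup>2) = 0"
    using inner_two_resolutions[OF assms F(1), of x "\<lambda>t. t" x "\<lambda>t. t"]
    by (simp flip: A_def F(2))
  then have zero: "(x s - t) * (x s - t) * (norm (E s \<star> F t))\<^sup>2 = 0" if "s \<in> S" "t \<in> T" for s t
    using that fin by (simp add: sum_nonneg_eq_0_iff sum_nonneg)
  have "(\<Sum>s\<in>S. \<Sum>t\<in>T. (f (x s) - f t) * (f (x s) - f t) * (norm (E s \<star> F t))\<^sup>2) = 0"
    by (intro sum.neutral ballI) (use zero in auto)
  then have "(\<Sum>s\<in>S. f (x s) *\<^sub>R E s) - (\<Sum>t\<in>T. f t *\<^sub>R F t) = 0"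
    using inner_two_resolutions[OF assms F(1), of "\<lambda>s. f (x s)" f "\<lambda>s. f (x s)" f] by simp
  then show ?thesis
    by (simp add: F(3) flip: A_def)
qed

lemma tfun_spectral:
  fixes A :: "('n::finite, 'n, 'p::finite) tensor"
  assumes "A\<^sup>H = A"
  obtains S E where "resolution S E" "\<And>s. A \<star> E s = s *\<^sub>R E s" "\<And>f. tfun f A = (\<Sum>s\<in>S. f s *\<^sub>R E s)"
proof -
  obtain S E where S: "resolution S E" "A = (\<Sum>s\<in>S. s *\<^sub>R E s)" "\<And>s. A \<star> E s = s *\<^sub>R E s"
    using spectral_resolution[OF assms] by metis
  have "tfun f A = (\<Sum>s\<in>S. f s *\<^sub>R E s)" for f
    using tfun_resolution[OF S(1), of f "\<lambda>s. s"] S(2) by simp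
  with S show thesis
    using that by blast
qed

lemma tfun_id:
  assumes "A\<^sup>H = A"
  shows "tfun (\<lambda>s. s) A = A"
proof -
  obtain S E where "resolution S E" "A = (\<Sum>s\<in>S. s *\<^sub>R E s)"
    using spectral_resolution[OF assms] by metis
  then show ?thesis
    using tfun_resolution[of S E "\<lambda>s. s" "\<lambda>s. s"] by simp
qed

lemma tfun_one:
  assumes "A\<^sup>H = A"
  shows "tfun (\<lambda>s. 1) A = tident"
proof -
  obtain S E where S: "resolution S E" "\<And>f. tfun f A = (\<Sum>s\<in>S. f s *\<^sub>R E s)"
    using tfun_spectral[OF assms] by metis
  show ?thesis
    using S(1) by (simp add: S(2) resolution_def)
qed

lemma tfun_hermitian:
  fixes A :: "('n::finite, 'n, 'p::finite) tensor"
  assumes "A\<^sup>H = A"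
  shows "(tfun f A)\<^sup>H = tfun f A"
proof -
  obtain S E where S: "resolution S E" "\<And>f. tfun f A = (\<Sum>s\<in>S. f s *\<^sub>R E s)"
    using tfun_spectral[OF assms] by metis
  have lin: "linear (tconj_transpose :: ('n, 'n, 'p) tensor \<Rightarrow> _)"
    by (rule linear_tadjoint)
  show ?thesis
    using S(1) by (simp add: S(2) linear_sum[OF lin] linear_scale[OF lin] resolution_def)
qed

lemma tfun_mult:
  assumes "A\<^sup>H = A"
  shows "tfun f A \<star> tfun g A = tfun (\<lambda>s. f s * g s) A"
proof -
  obtain S E where S: "resolution S E" "\<And>f. tfun f A = (\<Sum>s\<in>S. f s *\<^sub>R E s)"
    using tfun_spectral[OF assms] by metis
  have "tfun f A \<star> tfun g A = (\<Sum>s\<in>S. \<Sum>t\<in>S. if t = s then (f s * g s) *\<^sub>R E s else 0)"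
    unfolding S(2) tprod.sum_left unfolding tprod.sum_right tprod.scaleR_left tprod.scaleR_right
    using S(1) by (intro sum.cong refl) (auto simp: resolution_def)
  also have "\<dots> = tfun (\<lambda>s. f s * g s) A"
    using S(1) by (simp add: S(2) resolution_def)
  finally show ?thesis .
qed

lemma tfun_compose:
  assumes "A\<^sup>H = A"
  shows "tfun g (tfun f A) = tfun (\<lambda>s. g (f s)) A"
proof -
  obtain S E where S: "resolution S E" "\<And>f. tfun f A = (\<Sum>s\<in>S. f s *\<^sub>R E s)"
    using tfun_spectral[OF assms] by metis
  show ?thesis
    using tfun_resolution[OF S(1), of g f] by (simp add: S(2))
qed

lemma tfun_scaleR:
  assumes "A\<^sup>H = A"
  shows "tfun f (c *\<^sub>R A) = tfun (\<lambda>s. f (c * s)) A"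
proof -
  obtain S E where S: "resolution S E" "A = (\<Sum>s\<in>S. s *\<^sub>R E s)"
    using spectral_resolution[OF assms] by metis
  have "c *\<^sub>R A = (\<Sum>s\<in>S. (c * s) *\<^sub>R E s)"
    by (subst S(2)) (simp add: scaleR_sum_right)
  then show ?thesis
    using tfun_resolution[OF S(1), of f "\<lambda>s. c * s"] tfun_resolution[OF S(1), of "\<lambda>s. f (c * s)" "\<lambda>s. s"] S(2)
    by simp
qed

section \<open>T-positive definite tensors\<close>

lemma T_pos_def_hermitian: "A \<in> T_pos_def \<Longrightarrow> A\<^sup>H = A"
  by (simp add: T_pos_def_def T_Hermitian_iff)

lemma tident_pos_def: "tident \<in> T_pos_def"
  by (auto simp: T_pos_def_def T_Hermitian_iff tinner_cmod)

lemma T_pos_def_congruence: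
  fixes P G :: "('n::finite, 'n, 'p::finite) tensor"
  assumes "P \<in> T_pos_def" and inv: "G \<star> G' = tident"
  shows "G \<star> P \<star> G\<^sup>H \<in> T_pos_def"
proof -
  have inv_adj: "G'\<^sup>H \<star> G\<^sup>H = tident"
    by (simp flip: tadjoint_tprod add: inv)
  have "(G \<star> P \<star> G\<^sup>H)\<^sup>H = G \<star> P \<star> G\<^sup>H"
    using T_pos_def_hermitian[OF assms(1)] by (simp add: tadjoint_tprod tprod_assoc)
  moreover have "tinner X ((G \<star> P \<star> G\<^sup>H) \<star> X) \<in> \<real> \<and> 0 < Re (tinner X ((G \<star> P \<star> G\<^sup>H) \<star> X))"
    if "X \<noteq> 0" for X :: "('n, 1, 'p) tensor"
  proof -
    have "G\<^sup>H \<star> X \<noteq> 0"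
    proof
      assume "G\<^sup>H \<star> X = 0"
      then have "G'\<^sup>H \<star> (G\<^sup>H \<star> X) = 0"
        by (simp add: tprod.zero_right)
      then show False
        using that by (simp add: inv_adj flip: tprod_assoc)
    qed
    moreover have "tinner X ((G \<star> P \<star> G\<^sup>H) \<star> X) = tinner (G\<^sup>H \<star> X) (P \<star> (G\<^sup>H \<star> X))"
      by (simp add: tinner_tprod_left tprod_assoc)
    ultimately show ?thesis
      using assms(1) by (simp add: T_pos_def_def)
  qed
  ultimately show ?thesis
    by (simp add: T_pos_def_def T_Hermitian_iff)
qed

text \<open>A nonzero column of \<open>E\<close> is an eigenvector to which the definition of positivity applies.\<close>

lemma T_pos_def_eigenvalue_pos:
  fixes A E :: "('n::finite, 'n, 'p::finite) tensor"
  assumes "A \<in> T_pos_def" "A \<star> E = s *\<^sub>R E" "E \<noteq> 0"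
  shows "s > 0"
proof -
  obtain k i j where "E $ k $ i $ j \<noteq> 0"
    using \<open>E \<noteq> 0\<close> by (auto simp: vec_eq_iff)
  define X :: "('n, 1, 'p) tensor" where "X = (\<chi> k i _. E $ k $ i $ j)"
  have "X \<noteq> 0"
    using \<open>E $ k $ i $ j \<noteq> 0\<close> by (auto simp: X_def vec_eq_iff)
  have "(A \<star> X) $ k $ i $ l = (A \<star> E) $ k $ i $ j" for k i l
    by (simp add: tprod_nth X_def)
  then have "A \<star> X = s *\<^sub>R X"
    by (simp add: vec_eq_iff assms(2) X_def)
  then have "Re (tinner X (A \<star> X)) = s * (norm X)\<^sup>2"
    by (simp add: Re_tinner dot_square_norm)
  then show ?thesis
    using assms(1) \<open>X \<noteq> 0\<close> by (auto simp: T_pos_def_def zero_less_mult_iff)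
qed

lemma tfun_spectral_pos:
  fixes P :: "('n::finite, 'n, 'p::finite) tensor"
  assumes "P \<in> T_pos_def"
  obtains S E where "resolution S E" "\<And>s. E s \<noteq> 0 \<Longrightarrow> s > 0" "\<And>f. tfun f P = (\<Sum>s\<in>S. f s *\<^sub>R E s)"
  using tfun_spectral[OF T_pos_def_hermitian[OF assms]] T_pos_def_eigenvalue_pos[OF assms] by metis

lemma tfun_cong_pos:
  assumes "P \<in> T_pos_def" "\<And>s. s > 0 \<Longrightarrow> f s = g s"
  shows "tfun f P = tfun g P"
proof -
  obtain S E where S: "resolution S E" "\<And>s. E s \<noteq> 0 \<Longrightarrow> s > 0" "\<And>f. tfun f P = (\<Sum>s\<in>S. f s *\<^sub>R E s)"
    using tfun_spectral_pos[OF assms(1)] by metis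
  have "f s *\<^sub>R E s = g s *\<^sub>R E s" for s
    using S(2)[of s] assms(2)[of s] by (cases "E s = 0") simp_all
  then show ?thesis
    by (simp only: S(3))
qed

text \<open>\<open>f(A)\<close> is the congruence of the identity tensor by \<open>\<surd>f(A)\<close>.\<close>

lemma tfun_pos_def:
  assumes "A\<^sup>H = A" "\<And>s. f s > 0"
  shows "tfun f A \<in> T_pos_def"
proof -
  let ?R = "tfun (\<lambda>s. sqrt (f s)) A"
  have "?R \<star> tfun (\<lambda>s. inverse (sqrt (f s))) A = tident"
    using assms(2) by (simp add: tfun_mult[OF assms(1)] less_imp_neq[THEN not_sym] tfun_one[OF assms(1)])
  from T_pos_def_congruence[OF tident_pos_def this]
  have "?R \<star> ?R \<in> T_pos_def"
    by (simp add: tfun_hermitian[OF assms(1)])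
  also have "?R \<star> ?R = tfun f A"
    using assms(2) by (simp add: tfun_mult[OF assms(1)] less_imp_le)
  finally show ?thesis .
qed

lemma tinv_pos_def:
  assumes "P \<in> T_pos_def"
  shows "tinv P = tfun inverse P" "P \<star> tinv P = tident" "tinv P \<star> P = tident"
proof -
  note herm = T_pos_def_hermitian[OF assms]
  have "tfun (\<lambda>s. s) P \<star> tfun inverse P = tident" "tfun inverse P \<star> tfun (\<lambda>s. s) P = tident"
    unfolding tfun_mult[OF herm] tfun_one[OF herm, symmetric] by (auto intro!: tfun_cong_pos[OF assms])
  then have inv: "P \<star> tfun inverse P = tident" "tfun inverse P \<star> P = tident"
    unfolding tfun_id[OF herm] .
  show "tinv P = tfun inverse P"
    by (rule tinv_unique[OF inv])
  with inv show "P \<star> tinv P = tident" "tinv P \<star> P = tident"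
    by simp_all
qed

lemma tlog_texp: "X\<^sup>H = X \<Longrightarrow> tfun ln (tfun exp X) = X"
  by (simp add: tfun_compose tfun_id)

lemma texp_tlog:
  assumes "P \<in> T_pos_def"
  shows "tfun exp (tfun ln P) = P"
proof -
  note herm = T_pos_def_hermitian[OF assms]
  have "tfun exp (tfun ln P) = tfun (\<lambda>s. s) P"
    unfolding tfun_compose[OF herm] by (rule tfun_cong_pos[OF assms]) simp
  then show ?thesis
    by (simp add: tfun_id[OF herm])
qed

lemma two_ln_le_diff_inverse:
  fixes u :: real
  assumes "u \<ge> 1"
  shows "2 * ln u \<le> u - inverse u"
proof -
  define g where "g u = u - inverse u - 2 * ln u" for u :: real
  have "g 1 \<le> g u"
  proof (rule DERIV_nonneg_imp_nondecreasing[OF assms])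
    fix x :: real assume "1 \<le> x"
    then have "(g has_real_derivative 1 + inverse (x\<^sup>2) - 2 / x) (at x)"
      unfolding g_def by (auto intro!: derivative_eq_intros simp: field_simps power2_eq_square)
    moreover have "1 + inverse (x\<^sup>2) - 2 / x = (1 - inverse x)\<^sup>2"
      using \<open>1 \<le> x\<close> by (simp add: field_simps power2_eq_square)
    ultimately show "\<exists>y. (g has_real_derivative y) (at x) \<and> 0 \<le> y"
      by (metis zero_le_power2)
  qed
  then show ?thesis
    by (simp add: g_def)
qed

text \<open>With \<open>u = \<surd>(s/t)\<close> this is, for \<open>s \<ge> t\<close>, the square of \<open>2 ln u \<le> u - 1/u\<close>.\<close>

lemma ln_diff_square_le:
  fixes s t :: real
  assumes "s > 0" "t > 0"
  shows "(ln s - ln t)\<^sup>2 \<le> (s - t) * (inverse t - inverse s)"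
proof -
  have main: "(ln s - ln t)\<^sup>2 \<le> (s - t) * (inverse t - inverse s)" if "s \<ge> t" "t > 0" for s t :: real
  proof -
    define u where "u = sqrt (s / t)"
    have "s > 0" and "u \<ge> 1"
      using that by (auto simp: u_def)
    have u2: "u\<^sup>2 = s / t"
      using that by (simp add: u_def)
    have "ln s - ln t = ln (u\<^sup>2)"
      using that \<open>s > 0\<close> by (simp add: u2 ln_div)
    also have "\<dots> = 2 * ln u"
      using \<open>u \<ge> 1\<close> by (simp add: ln_realpow)
    finally have "(ln s - ln t)\<^sup>2 = (2 * ln u)\<^sup>2"
      by simp
    also have "\<dots> \<le> (u - inverse u)\<^sup>2"
      using two_ln_le_diff_inverse[OF \<open>u \<ge> 1\<close>] \<open>u \<ge> 1\<close> by (intro power_mono) simp_all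
    also have "(u - inverse u)\<^sup>2 = u\<^sup>2 + inverse (u\<^sup>2) - 2"
      using \<open>u \<ge> 1\<close> by (simp add: power2_eq_square field_simps)
    also have "\<dots> = (s - t) * (inverse t - inverse s)"
      unfolding u2 using that \<open>s > 0\<close> by (simp add: field_simps)
    finally show ?thesis .
  qed
  show ?thesis
    using main[of s t] main[of t s] assms
    by (cases "s \<ge> t") (simp_all add: power2_commute algebra_simps)
qed

text \<open>
  In terms of the joint spectral weights of \<open>P\<close> and \<open>Q\<close> this is the scalar inequality
  \<open>(ln s - ln t)\<^sup>2 \<le> (s - t) (1/t - 1/s)\<close>, that is, \<open>x\<^sup>2 \<le> 4 sinh\<^sup>2 (x/2)\<close> for \<open>x = ln s - ln t\<close>.
  For \<open>P\<close> close to \<open>Q\<close> the right-hand side is asymptotically \<open>1/p\<close> times the squared Riemannian length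
  of \<open>P - Q\<close>: the inequality says that the logarithm does not increase infinitesimal lengths, and
  says so without differentiating the logarithm.
\<close>

lemma tlog_diff_le:
  assumes P: "P \<in> T_pos_def" and Q: "Q \<in> T_pos_def"
  shows "(norm (tfun ln P - tfun ln Q))\<^sup>2 \<le> (P - Q) \<bullet> (tinv Q - tinv P)"
proof -
  obtain S E where S: "resolution S E" "\<And>s. E s \<noteq> 0 \<Longrightarrow> s > 0" "\<And>f. tfun f P = (\<Sum>s\<in>S. f s *\<^sub>R E s)"
    using tfun_spectral_pos[OF P] by metis
  obtain T F where T: "resolution T F" "\<And>s. F s \<noteq> 0 \<Longrightarrow> s > 0" "\<And>f. tfun f Q = (\<Sum>s\<in>T. f s *\<^sub>R F s)"
    using tfun_spectral_pos[OF Q] by metis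
  have "(norm (tfun ln P - tfun ln Q))\<^sup>2
      = (\<Sum>s\<in>S. \<Sum>t\<in>T. (ln s - ln t) * (ln s - ln t) * (norm (E s \<star> F t))\<^sup>2)"
    using inner_two_resolutions[OF S(1) T(1), of ln ln ln ln] by (simp add: S(3) T(3) flip: dot_square_norm)
  also have "\<dots> \<le> (\<Sum>s\<in>S. \<Sum>t\<in>T. (s - t) * (- inverse s - (- inverse t)) * (norm (E s \<star> F t))\<^sup>2)"
  proof (intro sum_mono)
    fix s t
    show "(ln s - ln t) * (ln s - ln t) * (norm (E s \<star> F t))\<^sup>2
        \<le> (s - t) * (- inverse s - (- inverse t)) * (norm (E s \<star> F t))\<^sup>2"
    proof (cases "E s = 0 \<or> F t = 0")
      case False
      then have "s > 0" "t > 0"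
        using S(2) T(2) by auto
      from ln_diff_square_le[OF this] show ?thesis
        by (intro mult_right_mono) (simp_all add: power2_eq_square)
    qed (auto simp: tprod.zero_left tprod.zero_right)
  qed
  also have "\<dots> = (tfun (\<lambda>s. s) P - tfun (\<lambda>s. s) Q) \<bullet> (tfun (\<lambda>s. - inverse s) P - tfun (\<lambda>s. - inverse s) Q)"
    using inner_two_resolutions[OF S(1) T(1), of "\<lambda>s. s" "\<lambda>s. s" "\<lambda>s. - inverse s" "\<lambda>s. - inverse s"]
    by (simp only: S(3) T(3))
  also have "tfun (\<lambda>s. - inverse s) P = - tinv P"
    by (simp add: S(3) tinv_pos_def[OF P] sum_negf)
  also have "tfun (\<lambda>s. - inverse s) Q = - tinv Q"
    by (simp add: T(3) tinv_pos_def[OF Q] sum_negf)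
  finally show ?thesis
    using T_pos_def_hermitian[OF P] T_pos_def_hermitian[OF Q] by (simp add: tfun_id)
qed

lemma tinv_diff:
  assumes "P \<in> T_pos_def" "Q \<in> T_pos_def"
  shows "tinv Q - tinv P = tinv Q \<star> (P - Q) \<star> tinv P"
  using tinv_pos_def(2,3)[OF assms(1)] tinv_pos_def(2,3)[OF assms(2)]
  by (simp add: tprod.diff_left tprod.diff_right tprod_assoc)

text \<open>
  By \<open>P\<^sup>-\<^sup>1 - Q\<^sup>-\<^sup>1 = Q\<^sup>-\<^sup>1 (Q - P) P\<^sup>-\<^sup>1\<close>, the norm of \<open>P\<^sup>-\<^sup>1\<close> is at most twice that of \<open>Q\<^sup>-\<^sup>1\<close> as soon as \<open>P\<close>
  is close to \<open>Q\<close>, and then the same identity is a Lipschitz estimate at \<open>Q\<close>.  The constant \<open>K\<close>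
  bounds the bilinear T-product.
\<close>

lemma continuous_on_tinv: "continuous_on (T_pos_def :: ('n::finite, 'n, 'p::finite) tensor set) tinv"
  unfolding continuous_on_def
proof
  fix Q :: "('n, 'n, 'p) tensor" assume Q: "Q \<in> T_pos_def"
  obtain K where "K > 0" and K: "\<And>A B. norm ((A :: ('n, 'n, 'p) tensor) \<star> (B :: ('n, 'n, 'p) tensor)) \<le> norm A * norm B * K"
    using tprod.pos_bounded by blast
  define q where "q = norm (tinv Q)"
  have "q \<ge> 0"
    by (simp add: q_def)
  have lip: "norm (tinv P - tinv Q) \<le> 2 * q\<^sup>2 * K\<^sup>2 * norm (P - Q)"
    if P: "P \<in> T_pos_def" and near: "norm (P - Q) * (2 * q * K\<^sup>2) \<le> 1" for P
  proof -
    define r where "r = norm (tinv P)"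
    have "norm (tinv P - tinv Q) = norm (tinv Q \<star> (P - Q) \<star> tinv P)"
      by (metis norm_minus_commute tinv_diff P Q)
    also have "\<dots> \<le> (q * norm (P - Q) * K) * r * K"
      unfolding q_def r_def using \<open>K > 0\<close>
      by (intro order_trans[OF K] mult_right_mono K) simp_all
    finally have diff: "norm (tinv P - tinv Q) \<le> (q * norm (P - Q) * K\<^sup>2) * r"
      by (simp add: power2_eq_square ac_simps)
    also have "\<dots> \<le> (1 / 2) * r"
      using near by (intro mult_right_mono) (simp_all add: r_def ac_simps)
    finally have "r \<le> 2 * q"
      using norm_triangle_ineq2[of "tinv P" "tinv Q"] by (simp add: r_def q_def)
    then have "(q * norm (P - Q) * K\<^sup>2) * r \<le> (q * norm (P - Q) * K\<^sup>2) * (2 * q)"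
      using \<open>q \<ge> 0\<close> by (intro mult_left_mono) simp_all
    with diff show ?thesis
      by (simp add: power2_eq_square ac_simps)
  qed
  have lim: "((\<lambda>P. norm (P - Q)) \<longlongrightarrow> 0) (at Q within T_pos_def)"
    by (auto intro!: tendsto_eq_intros)
  have "((\<lambda>P. norm (P - Q) * (2 * q * K\<^sup>2)) \<longlongrightarrow> 0) (at Q within T_pos_def)"
    by (auto intro!: tendsto_eq_intros lim)
  then have "\<forall>\<^sub>F P in at Q within T_pos_def. norm (P - Q) * (2 * q * K\<^sup>2) < 1"
    by (rule order_tendstoD) simp
  moreover have "\<forall>\<^sub>F P in at Q within T_pos_def. P \<in> T_pos_def"
    by (simp add: eventually_at_filter)
  ultimately have "\<forall>\<^sub>F P in at Q within T_pos_def. norm (tinv P - tinv Q) \<le> 2 * q\<^sup>2 * K\<^sup>2 * norm (P - Q)"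
    by eventually_elim (simp add: lip)
  moreover have "((\<lambda>P. 2 * q\<^sup>2 * K\<^sup>2 * norm (P - Q)) \<longlongrightarrow> 0) (at Q within T_pos_def)"
    by (auto intro!: tendsto_eq_intros lim)
  ultimately have "((\<lambda>P. tinv P - tinv Q) \<longlongrightarrow> 0) (at Q within T_pos_def)"
    by (rule Lim_null_comparison)
  then show "(tinv \<longlongrightarrow> tinv Q) (at Q within T_pos_def)"
    by (simp add: LIM_zero_iff)
qed

section \<open>The logarithm does not increase lengths\<close>

text \<open>
  A mean value inequality in which a pointwise bound on difference quotients takes the place of a
  derivative.  On a tagged division that is fine enough, add up this bound over the two parts into
  which the tag divides each interval, and compare the result with the Riemann sum of \<open>v\<close>.
\<close>

lemma norm_diff_le_integral:
  fixes f :: "real \<Rightarrow> 'a::real_normed_vector" and v :: "real \<Rightarrow> real"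
  assumes "a \<le> b" and v: "v integrable_on {a..b}"
    and loc: "\<And>t e. t \<in> {a..b} \<Longrightarrow> e > 0 \<Longrightarrow>
      \<exists>d>0. \<forall>s\<in>{a..b}. \<bar>s - t\<bar> < d \<longrightarrow> norm (f s - f t) \<le> (v t + e) * \<bar>s - t\<bar>"
  shows "norm (f b - f a) \<le> integral {a..b} v"
proof -
  have approx: "norm (f b - f a) \<le> integral {a..b} v + 2 * e * (b - a)" if e: "e > 0" for e :: real
  proof -
    obtain \<delta> where \<delta>: "\<And>t. t \<in> {a..b} \<Longrightarrow> \<delta> t > 0"
      "\<And>t s. t \<in> {a..b} \<Longrightarrow> s \<in> {a..b} \<Longrightarrow> \<bar>s - t\<bar> < \<delta> t \<Longrightarrow> norm (f s - f t) \<le> (v t + e) * \<bar>s - t\<bar>"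
      using loc[OF _ e] by metis
    define \<eta> where "\<eta> t = (if t \<in> {a..b} then \<delta> t else 1)" for t
    have g2: "gauge (\<lambda>t. ball t (\<eta> t))"
      using \<delta>(1) by (auto simp: gauge_def \<eta>_def)
    obtain g1 where g1: "gauge g1" and sum1: "\<And>p. p tagged_division_of {a..b} \<Longrightarrow> g1 fine p \<Longrightarrow>
        norm ((\<Sum>(x, k)\<in>p. measure lborel k *\<^sub>R v x) - integral {a..b} v) \<le> e * measure lborel {a..b}"
      using has_integral_factor_content_real[THEN iffD1, OF integrable_integral[OF v]] e by metis
    obtain p where p: "p tagged_division_of {a..b}" and "(\<lambda>x. g1 x \<inter> ball x (\<eta> x)) fine p"
      using fine_division_exists_real[OF gauge_Int[OF g1 g2]] by blast
    then have fine: "g1 fine p" "(\<lambda>t. ball t (\<eta> t)) fine p"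
      by (auto simp: fine_Int)
    have "norm (f b - f a) = norm (\<Sum>(x, k)\<in>p. f (Sup k) - f (Inf k))"
      by (simp only: additive_tagged_division_1[OF \<open>a \<le> b\<close> p])
    also have "\<dots> \<le> (\<Sum>(x, k)\<in>p. norm (f (Sup k) - f (Inf k)))"
      using norm_sum[of "\<lambda>(x, k). f (Sup k) - f (Inf k)" p] by (simp add: split_def)
    also have "\<dots> \<le> (\<Sum>(x, k)\<in>p. measure lborel k *\<^sub>R v x + e * (Sup k - Inf k))"
    proof (rule sum_mono, clarify)
      fix x k assume xk: "(x, k) \<in> p"
      obtain c d where k: "k = {c..d}"
        using tagged_division_ofD(4)[OF p xk] by auto
      have x: "c \<le> x" "x \<le> d" and sub: "{c..d} \<subseteq> {a..b}"
        using tagged_division_ofD(2,3)[OF p xk] by (auto simp: k)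
      have mem: "x \<in> {a..b}" "c \<in> {a..b}" "d \<in> {a..b}"
        using x sub by auto
      have "{c..d} \<subseteq> ball x (\<eta> x)"
        using fine(2) xk by (auto simp: fine_def k)
      from subsetD[OF this, of c] subsetD[OF this, of d] have "c \<in> ball x (\<eta> x)" "d \<in> ball x (\<eta> x)"
        using x by simp_all
      then have "\<bar>c - x\<bar> < \<delta> x" "\<bar>d - x\<bar> < \<delta> x"
        using mem(1) by (simp_all add: \<eta>_def dist_real_def abs_minus_commute)
      with \<delta>(2) mem have "norm (f c - f x) \<le> (v x + e) * \<bar>c - x\<bar>" "norm (f d - f x) \<le> (v x + e) * \<bar>d - x\<bar>"
        by blast+
      then have "norm (f d - f c) \<le> (v x + e) * \<bar>c - x\<bar> + (v x + e) * \<bar>d - x\<bar>"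
        using norm_triangle_ineq4[of "f d - f x" "f c - f x"] by simp
      also have "\<dots> = measure lborel k *\<^sub>R v x + e * (Sup k - Inf k)"
        using x by (simp add: k algebra_simps)
      finally show "norm (f (Sup k) - f (Inf k)) \<le> measure lborel k *\<^sub>R v x + e * (Sup k - Inf k)"
        using x by (simp add: k)
    qed
    also have "\<dots> = (\<Sum>(x, k)\<in>p. measure lborel k *\<^sub>R v x) + e * (\<Sum>(x, k)\<in>p. Sup k - Inf k)"
      by (simp add: split_def sum.distrib sum_distrib_left)
    also have "(\<Sum>(x, k)\<in>p. Sup k - Inf k) = b - a"
      using additive_tagged_division_1[OF \<open>a \<le> b\<close> p, of "\<lambda>x. x"] by simp
    also have "(\<Sum>(x, k)\<in>p. measure lborel k *\<^sub>R v x) \<le> integral {a..b} v + e * (b - a)"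
      using sum1[OF p fine(1)] \<open>a \<le> b\<close> by (simp add: abs_le_iff)
    finally show ?thesis
      by simp
  qed
  show ?thesis
  proof (rule field_le_epsilon)
    fix e :: real assume "e > 0"
    define l where "l = b - a + 1"
    have "l > 0"
      using \<open>a \<le> b\<close> by (simp add: l_def)
    define e' where "e' = e / (2 * l)"
    have "e' > 0"
      using \<open>e > 0\<close> \<open>l > 0\<close> by (simp add: e'_def)
    have "2 * e' * (b - a) \<le> 2 * e' * l"
      using \<open>e' > 0\<close> by (intro mult_left_mono) (simp_all add: l_def)
    also have "\<dots> = e"
      using \<open>l > 0\<close> by (simp add: e'_def)
    finally show "norm (f b - f a) \<le> integral {a..b} v + e"
      using approx[OF \<open>e' > 0\<close>] by simp
  qed
qed

lemma riem_metric_eq: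
  fixes P X :: "('n::finite, 'n, 'p::finite) tensor"
  assumes "P \<in> T_pos_def" "X\<^sup>H = X"
  shows "riem_metric P X X = real CARD('p) * (X \<bullet> (tinv P \<star> X \<star> tinv P))"
proof -
  have "riem_metric P X X = real CARD('p) * ((tinv P \<star> X \<star> tinv P)\<^sup>H \<bullet> X)"
    unfolding riem_metric_def by (rule Re_ttrace_tprod)
  moreover have "(tinv P)\<^sup>H = tinv P"
    using assms(1) by (simp add: tinv_pos_def(1) tfun_hermitian T_pos_def_hermitian)
  then have "(tinv P \<star> X \<star> tinv P)\<^sup>H = tinv P \<star> X \<star> tinv P"
    by (simp add: tadjoint_tprod assms(2) tprod_assoc)
  ultimately show ?thesis
    by (simp only: inner_commute)
qed

text \<open>\<open>g\<^sub>P(X, X)\<close> is \<open>p\<close> times the square of the norm of \<open>P\<^sup>-\<^sup>1\<^sup>/\<^sup>2 * X * P\<^sup>-\<^sup>1\<^sup>/\<^sup>2\<close>.\<close>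

lemma riem_metric_nonneg:
  fixes P X :: "('n::finite, 'n, 'p::finite) tensor"
  assumes P: "P \<in> T_pos_def" and "X\<^sup>H = X"
  shows "0 \<le> riem_metric P X X"
proof -
  note herm = T_pos_def_hermitian[OF P]
  define R where "R = tfun (\<lambda>s. inverse (sqrt s)) P"
  have "R\<^sup>H = R"
    by (simp add: R_def tfun_hermitian[OF herm])
  have "tinv P = R \<star> R"
    unfolding R_def tinv_pos_def(1)[OF P] tfun_mult[OF herm]
    by (rule tfun_cong_pos[OF P]) (simp flip: inverse_mult_distrib)
  then have "X \<bullet> (tinv P \<star> X \<star> tinv P) = X \<bullet> ((R \<star> (R \<star> X \<star> R)) \<star> R\<^sup>H)"
    by (simp only: \<open>R\<^sup>H = R\<close> tprod_assoc)
  also have "\<dots> = (X \<star> R) \<bullet> (R\<^sup>H \<star> (R \<star> X \<star> R))"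
    by (simp only: inner_tprod_right \<open>R\<^sup>H = R\<close>)
  also have "\<dots> = (R \<star> X \<star> R) \<bullet> (R \<star> X \<star> R)"
    unfolding inner_tprod_left[symmetric] by (simp only: tprod_assoc)
  finally show ?thesis
    by (simp add: riem_metric_eq[OF assms])
qed

abbreviation riem_speed :: "(real \<Rightarrow> ('n::finite, 'n, 'p::finite) tensor) \<Rightarrow> real \<Rightarrow> real" where
  "riem_speed \<gamma> t \<equiv> sqrt (riem_metric (\<gamma> t) (vector_derivative \<gamma> (at t)) (vector_derivative \<gamma> (at t)))"

text \<open>The norm of the Riemannian metric at the identity tensor.\<close>

definition riem_norm :: "('n::finite, 'n, 'p::finite) tensor \<Rightarrow> real" where
  "riem_norm (X :: ('n, 'n, 'p) tensor) = sqrt (real CARD('p)) * norm X"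

lemma has_vector_derivative_difference_quotient:
  assumes "(f has_vector_derivative D) (at t within S)"
  shows "((\<lambda>s. inverse (s - t) *\<^sub>R (f s - f t)) \<longlongrightarrow> D) (at t within S)"
proof -
  have "((\<lambda>s. norm ((1 / norm (s - t)) *\<^sub>R (f s - (f t + (s - t) *\<^sub>R D)))) \<longlongrightarrow> 0) (at t within S)"
    using assms unfolding has_vector_derivative_def has_derivative_within by (intro tendsto_norm_zero) simp
  then have "((\<lambda>s. norm (inverse (s - t) *\<^sub>R (f s - f t) - D)) \<longlongrightarrow> 0) (at t within S)"
  proof (rule Lim_transform_eventually)
    have "norm ((1 / norm (s - t)) *\<^sub>R (f s - (f t + (s - t) *\<^sub>R D))) = norm (inverse (s - t) *\<^sub>R (f s - f t) - D)"
      if "s \<noteq> t" for s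
    proof -
      have "norm ((1 / norm (s - t)) *\<^sub>R (f s - (f t + (s - t) *\<^sub>R D)))
          = norm (inverse (s - t) *\<^sub>R (f s - (f t + (s - t) *\<^sub>R D)))"
        by (simp add: divide_inverse)
      also have "inverse (s - t) *\<^sub>R (f s - (f t + (s - t) *\<^sub>R D)) = inverse (s - t) *\<^sub>R (f s - f t) - D"
        using that by (simp add: scaleR_diff_right scaleR_add_right)
      finally show ?thesis .
    qed
    then show "\<forall>\<^sub>F s in at t within S. norm ((1 / norm (s - t)) *\<^sub>R (f s - (f t + (s - t) *\<^sub>R D)))
        = norm (inverse (s - t) *\<^sub>R (f s - f t) - D)"
      by (simp add: eventually_at_filter)
  qed
  then show ?thesis
    by (rule LIM_zero_cancel[OF tendsto_norm_zero_cancel])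
qed

lemma hermitian_derivative:
  fixes \<gamma> :: "real \<Rightarrow> ('n::finite, 'n, 'p::finite) tensor"
  assumes "a < b" "t \<in> {a..b}" "(\<gamma> has_vector_derivative D) (at t within {a..b})"
    and "\<And>s. s \<in> {a..b} \<Longrightarrow> (\<gamma> s)\<^sup>H = \<gamma> s"
  shows "D\<^sup>H = D"
proof -
  have bl: "bounded_linear (tconj_transpose :: ('n, 'n, 'p) tensor \<Rightarrow> _)"
    using linear_tadjoint linear_conv_bounded_linear by blast
  have "((\<lambda>s. (\<gamma> s)\<^sup>H) has_vector_derivative D\<^sup>H) (at t within {a..b})"
    by (rule bounded_linear.has_vector_derivative[OF bl assms(3)])
  then have "(\<gamma> has_vector_derivative D\<^sup>H) (at t within {a..b})"
    by (rule has_vector_derivative_transform[rotated 2]) (use assms(2,4) in auto)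
  then show ?thesis
    using vector_derivative_unique_within_closed_interval[of a b t \<gamma> "D\<^sup>H" D] assms(1-3)
    by simp
qed

text \<open>
  Divide the inequality \<open>\<parallel>log P - log Q\<parallel>\<^sup>2 \<le> \<langle>P - Q, Q\<^sup>-\<^sup>1 * (P - Q) * P\<^sup>-\<^sup>1\<rangle>\<close> for \<open>P = \<gamma> s\<close>, \<open>Q = \<gamma> t\<close>
  by \<open>(s - t)\<^sup>2\<close> and let \<open>s\<close> tend to \<open>t\<close>.
\<close>

lemma tlog_local_bound:
  fixes \<gamma> :: "real \<Rightarrow> ('n::finite, 'n, 'p::finite) tensor"
  assumes "a < b" and t: "t \<in> {a..b}" and D: "(\<gamma> has_vector_derivative D) (at t within {a..b})"
    and pos: "\<gamma> ` {a..b} \<subseteq> T_pos_def" and "e > 0"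
  shows "\<exists>d>0. \<forall>s\<in>{a..b}. \<bar>s - t\<bar> < d \<longrightarrow>
    riem_norm (tfun ln (\<gamma> s) - tfun ln (\<gamma> t)) \<le> (sqrt (riem_metric (\<gamma> t) D D) + e) * \<bar>s - t\<bar>"
proof -
  have posD: "\<gamma> s \<in> T_pos_def" if "s \<in> {a..b}" for s
    using pos that by blast
  define q where "q s = inverse (s - t) *\<^sub>R (\<gamma> s - \<gamma> t)" for s
  define w where "w s = real CARD('p) * (q s \<bullet> (tinv (\<gamma> t) \<star> q s \<star> tinv (\<gamma> s)))" for s
  define g where "g = riem_metric (\<gamma> t) D D"
  have "D\<^sup>H = D"
    using hermitian_derivative[OF \<open>a < b\<close> t D] posD T_pos_def_hermitian by blast
  then have g: "g = real CARD('p) * (D \<bullet> (tinv (\<gamma> t) \<star> D \<star> tinv (\<gamma> t)))" and "g \<ge> 0"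
    unfolding g_def using posD[OF t] by (rule riem_metric_eq[rotated], rule riem_metric_nonneg[rotated])
  have q: "(q \<longlongrightarrow> D) (at t within {a..b})"
    unfolding q_def by (rule has_vector_derivative_difference_quotient[OF D])
  have "(\<gamma> \<longlongrightarrow> \<gamma> t) (at t within {a..b})"
    using has_vector_derivative_continuous[OF D] by (simp add: continuous_within)
  then have "((\<lambda>s. tinv (\<gamma> s)) \<longlongrightarrow> tinv (\<gamma> t)) (at t within {a..b})"
    by (rule continuous_on_tendsto_compose[OF continuous_on_tinv _ posD[OF t]])
      (auto simp: eventually_at_filter posD)
  then have "(w \<longlongrightarrow> g) (at t within {a..b})"
    unfolding w_def g by (intro tendsto_intros tprod.tendsto q)
  moreover have "g < (sqrt g + e)\<^sup>2"
    using \<open>g \<ge> 0\<close> \<open>e > 0\<close> by (simp add: power2_sum add_pos_nonneg)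
  ultimately have "\<forall>\<^sub>F s in at t within {a..b}. w s < (sqrt g + e)\<^sup>2"
    by (rule order_tendstoD)
  then obtain d where "d > 0" and d: "\<And>s. s \<in> {a..b} \<Longrightarrow> s \<noteq> t \<Longrightarrow> \<bar>s - t\<bar> < d \<Longrightarrow> w s < (sqrt g + e)\<^sup>2"
    by (auto simp: eventually_at dist_real_def)
  have "riem_norm (tfun ln (\<gamma> s) - tfun ln (\<gamma> t)) \<le> (sqrt g + e) * \<bar>s - t\<bar>"
    if s: "s \<in> {a..b}" "\<bar>s - t\<bar> < d" for s
  proof (cases "s = t")
    case False
    have "\<gamma> s - \<gamma> t = (s - t) *\<^sub>R q s"
      using False by (simp add: q_def)
    then have eq: "tinv (\<gamma> t) - tinv (\<gamma> s) = (s - t) *\<^sub>R (tinv (\<gamma> t) \<star> q s \<star> tinv (\<gamma> s))"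
      by (simp add: tinv_diff[OF posD[OF s(1)] posD[OF t]] tprod.scaleR_left tprod.scaleR_right)
    have "(riem_norm (tfun ln (\<gamma> s) - tfun ln (\<gamma> t)))\<^sup>2
        = real CARD('p) * (norm (tfun ln (\<gamma> s) - tfun ln (\<gamma> t)))\<^sup>2"
      by (simp add: riem_norm_def power_mult_distrib)
    also have "\<dots> \<le> real CARD('p) * ((\<gamma> s - \<gamma> t) \<bullet> (tinv (\<gamma> t) - tinv (\<gamma> s)))"
      using tlog_diff_le[OF posD[OF s(1)] posD[OF t]] by (rule mult_left_mono) simp
    also have "\<dots> = (s - t)\<^sup>2 * w s"
      unfolding eq \<open>\<gamma> s - \<gamma> t = (s - t) *\<^sub>R q s\<close> by (simp add: w_def power2_eq_square)
    also have "\<dots> \<le> (s - t)\<^sup>2 * (sqrt g + e)\<^sup>2"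
      using d[OF s(1) False s(2)] by (intro mult_left_mono) simp_all
    also have "\<dots> = ((sqrt g + e) * \<bar>s - t\<bar>)\<^sup>2"
      by (simp add: power_mult_distrib)
    finally show ?thesis
      by (rule power2_le_imp_le) (use \<open>g \<ge> 0\<close> \<open>e > 0\<close> in simp)
  qed (simp add: riem_norm_def)
  then show ?thesis
    using \<open>d > 0\<close> by (auto simp: g_def)
qed

lemma riem_norm_nonneg [simp]: "0 \<le> riem_norm X"
  by (simp add: riem_norm_def)

lemma riem_norm_zero [simp]: "riem_norm 0 = 0"
  by (simp add: riem_norm_def)

lemma riem_norm_scaleR: "riem_norm (c *\<^sub>R X) = \<bar>c\<bar> * riem_norm X"
  by (simp add: riem_norm_def)

text \<open>
  On a smooth piece the integrand of the length agrees, away from the end points, with a continuous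
  function, so that the length is a genuine integral there.
\<close>

lemma smooth_piece_length:
  fixes \<gamma> :: "real \<Rightarrow> ('n::finite, 'n, 'p::finite) tensor"
  assumes "a < b" and smooth: "smooth_on {a..b} \<gamma>" and pos: "\<gamma> ` {a..b} \<subseteq> T_pos_def"
  shows "\<exists>I. (riem_speed \<gamma> has_integral I) {a..b} \<and> riem_norm (tfun ln (\<gamma> b) - tfun ln (\<gamma> a)) \<le> I"
proof -
  have posD: "\<gamma> s \<in> T_pos_def" if "s \<in> {a..b}" for s
    using pos that by blast
  obtain D where D0: "D 0 = \<gamma>"
    and D: "\<And>k t. t \<in> {a..b} \<Longrightarrow> (D k has_vector_derivative D (Suc k) t) (at t within {a..b})"
    using smooth unfolding smooth_on_def by blast
  define \<gamma>' where "\<gamma>' = D (Suc 0)"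
  have der: "(\<gamma> has_vector_derivative \<gamma>' t) (at t within {a..b})" if "t \<in> {a..b}" for t
    using D[OF that, of 0] by (simp add: D0 \<gamma>'_def)
  have cont: "continuous_on {a..b} \<gamma>" "continuous_on {a..b} \<gamma>'"
    unfolding \<gamma>'_def by (rule continuous_on_vector_derivative, erule der, rule continuous_on_vector_derivative, erule D)
  define v where "v t = sqrt (riem_metric (\<gamma> t) (\<gamma>' t) (\<gamma>' t))" for t
  have "(\<gamma>' t)\<^sup>H = \<gamma>' t" if "t \<in> {a..b}" for t
    using hermitian_derivative[OF \<open>a < b\<close> that der[OF that]] posD T_pos_def_hermitian by blast
  then have v: "v t = sqrt (real CARD('p) * (\<gamma>' t \<bullet> (tinv (\<gamma> t) \<star> \<gamma>' t \<star> tinv (\<gamma> t))))" if "t \<in> {a..b}" for t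
    using riem_metric_eq[OF posD[OF that]] that by (simp add: v_def)
  have "continuous_on {a..b} (\<lambda>t. tinv (\<gamma> t))"
    using continuous_on_compose2[OF continuous_on_tinv cont(1) pos] .
  then have "continuous_on {a..b} (\<lambda>t. sqrt (real CARD('p) * (\<gamma>' t \<bullet> (tinv (\<gamma> t) \<star> \<gamma>' t \<star> tinv (\<gamma> t)))))"
    by (intro continuous_intros tprod.continuous_on cont)
  then have "continuous_on {a..b} v"
    by (rule continuous_on_cong[THEN iffD1, rotated 2]) (simp_all add: v)
  then have int: "v integrable_on {a..b}"
    by (rule integrable_continuous_interval)
  have "(riem_speed \<gamma> has_integral integral {a..b} v) {a..b}"
  proof (rule has_integral_spike_finite[OF _ _ integrable_integral[OF int]])
    show "finite {a, b}"
      by simp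
    fix t assume t: "t \<in> {a..b} - {a, b}"
    then have "at t within {a..b} = at t"
      by (intro at_within_interior) simp
    then have "vector_derivative \<gamma> (at t) = \<gamma>' t"
      using der[of t] t by (simp add: vector_derivative_at)
    then show "riem_speed \<gamma> t = v t"
      by (simp add: v_def)
  qed
  moreover have "riem_norm (tfun ln (\<gamma> b) - tfun ln (\<gamma> a)) \<le> integral {a..b} v"
  proof -
    have "norm (sqrt (real CARD('p)) *\<^sub>R tfun ln (\<gamma> b) - sqrt (real CARD('p)) *\<^sub>R tfun ln (\<gamma> a)) \<le> integral {a..b} v"
    proof (rule norm_diff_le_integral[OF less_imp_le[OF \<open>a < b\<close>] int])
      fix t e :: real assume "t \<in> {a..b}" "e > 0"
      from tlog_local_bound[OF \<open>a < b\<close> this(1) der[OF this(1)] pos this(2)]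
      show "\<exists>d>0. \<forall>s\<in>{a..b}. \<bar>s - t\<bar> < d \<longrightarrow>
          norm (sqrt (real CARD('p)) *\<^sub>R tfun ln (\<gamma> s) - sqrt (real CARD('p)) *\<^sub>R tfun ln (\<gamma> t)) \<le> (v t + e) * \<bar>s - t\<bar>"
        by (simp add: riem_norm_def v_def flip: scaleR_diff_right)
    qed
    then show ?thesis
      by (simp add: riem_norm_def flip: scaleR_diff_right)
  qed
  ultimately show ?thesis
    by blast
qed

lemma riem_norm_triangle: "riem_norm (X + Y) \<le> riem_norm X + riem_norm Y"
  unfolding riem_norm_def by (metis distrib_left mult_left_mono norm_triangle_ineq of_nat_0_le_iff real_sqrt_ge_zero)

lemma break_points_mono:
  fixes \<tau> :: "nat \<Rightarrow> real"
  assumes "\<And>i. i < m \<Longrightarrow> \<tau> i < \<tau> (Suc i)" "i \<le> j" "j \<le> m"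
  shows "\<tau> i \<le> \<tau> j"
  using assms(2,3)
proof (induction rule: dec_induct)
  case (step n)
  then show ?case
    using assms(1)[of n] by simp
qed simp

lemma piecewise_smooth_path_length:
  fixes \<gamma> :: "real \<Rightarrow> ('n::finite, 'n, 'p::finite) tensor"
  assumes "piecewise_smooth_path a b \<gamma> A B"
  shows "riem_norm (tfun ln B - tfun ln A) \<le> path_len a b \<gamma>"
proof -
  obtain m \<tau> where \<tau>: "\<tau> 0 = a" "\<tau> m = b" "\<And>i. i < m \<Longrightarrow> \<tau> i < \<tau> (Suc i)"
    "\<And>i. i < m \<Longrightarrow> smooth_on {\<tau> i..\<tau> (Suc i)} \<gamma>"
    and pos: "\<gamma> ` {a..b} \<subseteq> T_pos_def" and ends: "\<gamma> a = A" "\<gamma> b = B"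
    using assms unfolding piecewise_smooth_path_def piecewise_smooth_on_def by blast
  note mono = break_points_mono[of m \<tau>, OF \<tau>(3)]
  have "\<exists>I. (riem_speed \<gamma> has_integral I) {a..\<tau> k} \<and> riem_norm (tfun ln (\<gamma> (\<tau> k)) - tfun ln (\<gamma> a)) \<le> I"
    if "k \<le> m" for k
    using that
  proof (induction k)
    case 0
    then show ?case
      by (auto simp: \<tau>(1) intro!: exI[of _ 0])
  next
    case (Suc k)
    then have k: "k < m" "k \<le> m"
      by simp_all
    obtain I where I: "(riem_speed \<gamma> has_integral I) {a..\<tau> k}" "riem_norm (tfun ln (\<gamma> (\<tau> k)) - tfun ln (\<gamma> a)) \<le> I"
      using Suc.IH[OF k(2)] by blast
    have "a \<le> \<tau> k" "\<tau> (Suc k) \<le> b"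
      using mono[of 0 k] mono[of "Suc k" m] k \<tau>(1,2) by simp_all
    then have "\<gamma> ` {\<tau> k..\<tau> (Suc k)} \<subseteq> T_pos_def"
      using pos by (intro order_trans[OF image_mono pos]) simp
    from smooth_piece_length[OF \<tau>(3)[OF k(1)] \<tau>(4)[OF k(1)] this]
    obtain J where J: "(riem_speed \<gamma> has_integral J) {\<tau> k..\<tau> (Suc k)}"
      "riem_norm (tfun ln (\<gamma> (\<tau> (Suc k))) - tfun ln (\<gamma> (\<tau> k))) \<le> J"
      by blast
    have "(riem_speed \<gamma> has_integral I + J) {a..\<tau> (Suc k)}"
      using has_integral_combine[OF \<open>a \<le> \<tau> k\<close> _ I(1) J(1)] \<tau>(3)[OF k(1)] by simp
    moreover have "riem_norm (tfun ln (\<gamma> (\<tau> (Suc k))) - tfun ln (\<gamma> a)) \<le> I + J"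
      using riem_norm_triangle[of "tfun ln (\<gamma> (\<tau> (Suc k))) - tfun ln (\<gamma> (\<tau> k))" "tfun ln (\<gamma> (\<tau> k)) - tfun ln (\<gamma> a)"]
        I(2) J(2) by simp
    ultimately show ?case
      by blast
  qed
  from this[of m] obtain I where "(riem_speed \<gamma> has_integral I) {a..b}" "riem_norm (tfun ln B - tfun ln A) \<le> I"
    by (auto simp: \<tau>(2) ends)
  then show ?thesis
    by (simp add: path_len_def integral_unique)
qed

section \<open>The isometric action by congruences\<close>

lemma smooth_on_bounded_linear:
  assumes "bounded_linear L" "smooth_on S f"
  shows "smooth_on S (\<lambda>t. L (f t))"
proof -
  obtain D where "D 0 = f" "\<And>k t. t \<in> S \<Longrightarrow> (D k has_vector_derivative D (Suc k) t) (at t within S)"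
    using assms(2) unfolding smooth_on_def by blast
  then show ?thesis
    unfolding smooth_on_def using bounded_linear.has_vector_derivative[OF assms(1)]
    by (intro exI[of _ "\<lambda>k t. L (D k t)"]) auto
qed

text \<open>
  The vector derivative at a break point is an arbitrary value, which a congruence does not
  transport; the two integrands in question therefore agree only off a finite set.
\<close>

lemma piecewise_smooth_differentiable:
  assumes "piecewise_smooth_on a b f"
  obtains N where "finite N" "\<And>t. t \<in> {a..b} - N \<Longrightarrow> \<exists>D. (f has_vector_derivative D) (at t)"
proof -
  obtain m \<tau> where \<tau>: "\<tau> 0 = a" "\<tau> m = b" "\<And>i. i < m \<Longrightarrow> \<tau> i < \<tau> (Suc i)"
    "\<And>i. i < m \<Longrightarrow> smooth_on {\<tau> i..\<tau> (Suc i)} f"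
    using assms unfolding piecewise_smooth_on_def by blast
  have "\<exists>D. (f has_vector_derivative D) (at t)" if "k \<le> m" "t \<in> {a..\<tau> k} - \<tau> ` {..m}" for k t
    using that
  proof (induction k)
    case 0
    then show ?case
      by (auto simp flip: \<tau>(1))
  next
    case (Suc k)
    show ?case
    proof (cases "t \<le> \<tau> k")
      case True
      then show ?thesis
        using Suc by auto
    next
      case False
      have "k < m" "t \<noteq> \<tau> (Suc k)"
        using Suc.prems by auto
      then have t: "t \<in> interior {\<tau> k..\<tau> (Suc k)}" "t \<in> {\<tau> k..\<tau> (Suc k)}"
        using False Suc.prems by auto
      obtain D where "D 0 = f" "(D 0 has_vector_derivative D (Suc 0) t) (at t within {\<tau> k..\<tau> (Suc k)})"
        using \<tau>(4)[OF \<open>k < m\<close>] t(2) unfolding smooth_on_def by blast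
      then show ?thesis
        using at_within_interior[OF t(1)] by auto
    qed
  qed
  from this[of m] that[of "\<tau> ` {..m}"] show thesis
    by (simp add: \<tau>(2))
qed

context
  fixes G G' :: "('n::finite, 'n, 'p::finite) tensor"
  assumes inv: "G \<star> G' = tident" "G' \<star> G = tident"
begin

lemma inv_adjoint: "G\<^sup>H \<star> G'\<^sup>H = tident" "G'\<^sup>H \<star> G\<^sup>H = tident"
  by (simp_all flip: tadjoint_tprod add: inv)

lemma cancel_inverse: "G' \<star> (G \<star> X) = X" "G \<star> (G' \<star> X) = X" "G\<^sup>H \<star> (G'\<^sup>H \<star> X) = X" "G'\<^sup>H \<star> (G\<^sup>H \<star> X) = X"
  by (simp_all add: inv inv_adjoint flip: tprod_assoc)

lemma bounded_linear_congruence: "bounded_linear (\<lambda>X. G \<star> X \<star> G\<^sup>H)"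
  using bounded_linear_compose[OF tprod.bounded_linear_left[of "G\<^sup>H"] tprod.bounded_linear_right[of G]]
  by simp

lemma riem_metric_congruence:
  assumes "P \<in> T_pos_def"
  shows "riem_metric (G \<star> P \<star> G\<^sup>H) (G \<star> X \<star> G\<^sup>H) (G \<star> Y \<star> G\<^sup>H) = riem_metric P X Y"
proof -
  note P = tinv_pos_def(2,3)[OF assms]
  have P': "P \<star> (tinv P \<star> X) = X" "tinv P \<star> (P \<star> X) = X" for X :: "('n, 'n, 'p) tensor"
    by (simp_all add: P flip: tprod_assoc)
  have "tinv (G \<star> P \<star> G\<^sup>H) = G'\<^sup>H \<star> tinv P \<star> G'"
    by (rule tinv_unique) (simp_all add: tprod_assoc cancel_inverse P' inv inv_adjoint)
  then have "tinv (G \<star> P \<star> G\<^sup>H) \<star> (G \<star> X \<star> G\<^sup>H) \<star> tinv (G \<star> P \<star> G\<^sup>H) \<star> (G \<star> Y \<star> G\<^sup>H)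
      = G'\<^sup>H \<star> ((tinv P \<star> X \<star> tinv P \<star> Y) \<star> G\<^sup>H)"
    by (simp add: tprod_assoc cancel_inverse)
  moreover have "ttrace (G'\<^sup>H \<star> ((tinv P \<star> X \<star> tinv P \<star> Y) \<star> G\<^sup>H)) = ttrace (tinv P \<star> X \<star> tinv P \<star> Y)"
    by (subst ttrace_tprod_commute) (simp add: tprod_assoc inv_adjoint)
  ultimately show ?thesis
    by (simp add: riem_metric_def)
qed

lemma piecewise_smooth_path_congruence:
  assumes "piecewise_smooth_path a b \<gamma> A B"
  shows "piecewise_smooth_path a b (\<lambda>t. G \<star> \<gamma> t \<star> G\<^sup>H) (G \<star> A \<star> G\<^sup>H) (G \<star> B \<star> G\<^sup>H)"
    "path_len a b (\<lambda>t. G \<star> \<gamma> t \<star> G\<^sup>H) = path_len a b \<gamma>"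
proof -
  have smooth: "piecewise_smooth_on a b \<gamma>" and pos: "\<gamma> ` {a..b} \<subseteq> T_pos_def"
    using assms by (simp_all add: piecewise_smooth_path_def)
  have "piecewise_smooth_on a b (\<lambda>t. G \<star> \<gamma> t \<star> G\<^sup>H)"
    using smooth smooth_on_bounded_linear[OF bounded_linear_congruence]
    unfolding piecewise_smooth_on_def by blast
  then show "piecewise_smooth_path a b (\<lambda>t. G \<star> \<gamma> t \<star> G\<^sup>H) (G \<star> A \<star> G\<^sup>H) (G \<star> B \<star> G\<^sup>H)"
    using assms T_pos_def_congruence[OF _ inv(1)] by (auto simp: piecewise_smooth_path_def)
  obtain N where N: "finite N" "\<And>t. t \<in> {a..b} - N \<Longrightarrow> \<exists>D. (\<gamma> has_vector_derivative D) (at t)"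
    using piecewise_smooth_differentiable[OF smooth] by metis
  show "path_len a b (\<lambda>t. G \<star> \<gamma> t \<star> G\<^sup>H) = path_len a b \<gamma>"
    unfolding path_len_def
  proof (rule integral_spike[OF negligible_finite[OF N(1)]])
    fix t assume t: "t \<in> {a..b} - N"
    then obtain D where D: "(\<gamma> has_vector_derivative D) (at t)"
      using N(2) by blast
    then have "((\<lambda>t. G \<star> \<gamma> t \<star> G\<^sup>H) has_vector_derivative G \<star> D \<star> G\<^sup>H) (at t)"
      by (rule bounded_linear.has_vector_derivative[OF bounded_linear_congruence])
    then have "vector_derivative (\<lambda>t. G \<star> \<gamma> t \<star> G\<^sup>H) (at t) = G \<star> D \<star> G\<^sup>H"
      by (rule vector_derivative_at)
    moreover have "\<gamma> t \<in> T_pos_def"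
      using t pos by blast
    ultimately show "riem_speed \<gamma> t = riem_speed (\<lambda>t. G \<star> \<gamma> t \<star> G\<^sup>H) t"
      using vector_derivative_at[OF D] by (simp add: riem_metric_congruence)
  qed
qed

end

abbreviation path_lens :: "('n::finite, 'n, 'p::finite) tensor \<Rightarrow> ('n, 'n, 'p) tensor \<Rightarrow> real set" where
  "path_lens A B \<equiv> {path_len a b \<gamma> |a b \<gamma>. piecewise_smooth_path a b \<gamma> A B}"

lemma riem_dist_congruence:
  fixes G G' :: "('n::finite, 'n, 'p::finite) tensor"
  assumes inv: "G \<star> G' = tident" "G' \<star> G = tident" and "A \<in> T_pos_def" "B \<in> T_pos_def"
  shows "riem_dist (G \<star> A \<star> G\<^sup>H) (G \<star> B \<star> G\<^sup>H) = riem_dist A B"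
proof -
  have le: "path_lens A B \<subseteq> path_lens (G \<star> A \<star> G\<^sup>H) (G \<star> B \<star> G\<^sup>H)"
    if "G \<star> G' = tident" "G' \<star> G = tident" for G G' A B :: "('n, 'n, 'p) tensor"
    using piecewise_smooth_path_congruence[OF that] by (smt (verit, del_insts) Collect_mono)
  have "path_lens (G \<star> A \<star> G\<^sup>H) (G \<star> B \<star> G\<^sup>H) \<subseteq> path_lens A B"
    using le[OF inv(2,1), of "G \<star> A \<star> G\<^sup>H" "G \<star> B \<star> G\<^sup>H"]
    by (simp add: tprod_assoc cancel_inverse[OF inv] inv_adjoint[OF inv])
  with le[OF inv, of A B] have "path_lens (G \<star> A \<star> G\<^sup>H) (G \<star> B \<star> G\<^sup>H) = path_lens A B"
    by blast
  then show ?thesis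
    using assms(3,4) T_pos_def_congruence[OF _ inv(1)] by (simp add: riem_dist_def)
qed

section \<open>Geodesics\<close>

lemma smooth_on_cong:
  assumes "smooth_on S f" "\<And>t. t \<in> S \<Longrightarrow> g t = f t"
  shows "smooth_on S g"
proof -
  obtain D where D: "D 0 = f" "\<And>k t. t \<in> S \<Longrightarrow> (D k has_vector_derivative D (Suc k) t) (at t within S)"
    using assms(1) unfolding smooth_on_def by blast
  define D' where "D' k = (if k = 0 then g else D k)" for k
  have eq: "D' k t = D k t" if "t \<in> S" for k t
    using that assms(2) D(1) by (simp add: D'_def)
  have "(D' k has_vector_derivative D' (Suc k) t) (at t within S)" if "t \<in> S" for k t
    using has_vector_derivative_transform[OF that eq D(2)[OF that]] by (simp add: D'_def)
  then show ?thesis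
    unfolding smooth_on_def by (intro exI[of _ D']) (simp add: D'_def)
qed

lemma hermitian_scaleR: "X\<^sup>H = X \<Longrightarrow> (c *\<^sub>R X)\<^sup>H = c *\<^sub>R X"
  by (simp add: linear_scale[OF linear_tadjoint])

lemma texp_line_derivative:
  fixes X :: "('n::finite, 'n, 'p::finite) tensor"
  assumes "X\<^sup>H = X"
  shows "((\<lambda>r. tfun (\<lambda>x. (c * x) ^ k * exp ((s + r * c) * x)) X) has_vector_derivative
    tfun (\<lambda>x. (c * x) ^ Suc k * exp ((s + r * c) * x)) X) (at r within S)"
proof -
  obtain T E where T: "resolution T E" "\<And>f. tfun f X = (\<Sum>x\<in>T. f x *\<^sub>R E x)"
    using tfun_spectral[OF assms] by metis
  have "((\<lambda>r. (c * x) ^ k * exp ((s + r * c) * x)) has_real_derivative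
      (c * x) ^ Suc k * exp ((s + r * c) * x)) (at r within S)" for x
    by (auto intro!: derivative_eq_intros)
  then show ?thesis
    unfolding T(2) has_real_derivative_iff_has_vector_derivative
    by (intro has_vector_derivative_sum bounded_linear.has_vector_derivative[OF bounded_linear_scaleR_left])
qed

text \<open>
  Along \<open>\<gamma> r = exp ((s + r c) X)\<close> the derivative is \<open>c X * \<gamma> r\<close>, so that the speed is constant, namely
  the Riemannian norm of \<open>c X\<close> at the identity tensor.
\<close>

lemma texp_line:
  fixes X :: "('n::finite, 'n, 'p::finite) tensor" and \<gamma> :: "real \<Rightarrow> ('n, 'n, 'p) tensor"
  assumes X: "X\<^sup>H = X" and "a \<le> b"
    and \<gamma>: "\<And>r. r \<in> {a..b} \<Longrightarrow> \<gamma> r = tfun exp ((s + r * c) *\<^sub>R X)"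
  shows "smooth_on {a..b} \<gamma>" "\<gamma> ` {a..b} \<subseteq> T_pos_def"
    "(riem_speed \<gamma> has_integral (b - a) * (\<bar>c\<bar> * riem_norm X)) {a..b}"
proof -
  define D where "D k r = tfun (\<lambda>x. (c * x) ^ k * exp ((s + r * c) * x)) X" for k r
  have der: "(D k has_vector_derivative D (Suc k) r) (at r within S)" for k r S
    unfolding D_def by (rule texp_line_derivative[OF X])
  have \<gamma>D: "\<gamma> r = D 0 r" if "r \<in> {a..b}" for r
    by (simp add: \<gamma>[OF that] D_def tfun_scaleR[OF X])
  have pos: "D 0 r \<in> T_pos_def" for r
    unfolding D_def by (rule tfun_pos_def[OF X]) simp
  show "smooth_on {a..b} \<gamma>"
    by (rule smooth_on_cong[OF _ \<gamma>D]) (use der in \<open>auto simp: smooth_on_def\<close>)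
  show "\<gamma> ` {a..b} \<subseteq> T_pos_def"
    using \<gamma>D pos by auto
  have speed: "riem_metric (D 0 r) (D 1 r) (D 1 r) = (\<bar>c\<bar> * riem_norm X)\<^sup>2" for r
  proof -
    have cX: "c *\<^sub>R X = tfun (\<lambda>x. c * x) X"
      using tfun_scaleR[OF X, of "\<lambda>x. x" c] tfun_id[OF hermitian_scaleR[OF X], of c] by simp
    have tinv_D: "tinv (D 0 r) = tfun (\<lambda>x. inverse (exp ((s + r * c) * x))) X"
      unfolding tinv_pos_def(1)[OF pos] unfolding D_def tfun_compose[OF X] by simp
    have "tinv (D 0 r) \<star> D 1 r \<star> tinv (D 0 r) \<star> D 1 r = (c *\<^sub>R X) \<star> (c *\<^sub>R X)"
      unfolding tinv_D cX unfolding D_def tfun_mult[OF X] by (simp add: field_simps)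
    then show ?thesis
      unfolding riem_metric_def
      by (simp add: Re_ttrace_tprod hermitian_scaleR[OF X] riem_norm_def power_mult_distrib dot_square_norm
          del: One_nat_def inner_scaleR_left inner_scaleR_right)
  qed
  show "(riem_speed \<gamma> has_integral (b - a) * (\<bar>c\<bar> * riem_norm X)) {a..b}"
  proof (rule has_integral_spike_finite)
    show "finite {a, b}"
      by simp
    show "((\<lambda>_. \<bar>c\<bar> * riem_norm X) has_integral (b - a) * (\<bar>c\<bar> * riem_norm X)) {a..b}"
      using has_integral_const_real[of "\<bar>c\<bar> * riem_norm X" a b] \<open>a \<le> b\<close> by simp
    fix r assume r: "r \<in> {a..b} - {a, b}"
    have "(\<gamma> has_vector_derivative D 1 r) (at r)"
    proof (rule has_vector_derivative_transform_within_open[of "D 0"])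
      show "(D 0 has_vector_derivative D 1 r) (at r)"
        using der[of 0] by simp
      show "open {a<..<b}" "r \<in> {a<..<b}"
        using r by auto
    qed (simp add: \<gamma>D)
    then show "riem_speed \<gamma> r = \<bar>c\<bar> * riem_norm X"
      using r speed[of r] by (simp add: vector_derivative_at \<gamma>D del: One_nat_def)
  qed
qed

lemma texp_path:
  fixes X :: "('n::finite, 'n, 'p::finite) tensor" and s t :: real
  assumes X: "X\<^sup>H = X"
  defines "\<gamma> \<equiv> \<lambda>r. tfun exp ((s + r * (t - s)) *\<^sub>R X)"
  shows "piecewise_smooth_path 0 1 \<gamma> (tfun exp (s *\<^sub>R X)) (tfun exp (t *\<^sub>R X))"
    "path_len 0 1 \<gamma> = \<bar>t - s\<bar> * riem_norm X"
proof -
  note line = texp_line[OF X zero_le_one, of \<gamma> s "t - s"]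
  have "piecewise_smooth_on 0 1 \<gamma>"
    unfolding piecewise_smooth_on_def using line(1)
    by (intro exI[of _ "Suc 0"] exI[of _ real]) (simp add: \<gamma>_def)
  then show "piecewise_smooth_path 0 1 \<gamma> (tfun exp (s *\<^sub>R X)) (tfun exp (t *\<^sub>R X))"
    using line(2) by (simp add: piecewise_smooth_path_def \<gamma>_def)
  show "path_len 0 1 \<gamma> = \<bar>t - s\<bar> * riem_norm X"
    unfolding path_len_def using integral_unique[OF line(3)] by (simp add: \<gamma>_def)
qed

text \<open>
  The path runs through the identity tensor.  It gives the triangle inequality when the middle point
  is the identity tensor, and shows that any two points are joined by a path.
\<close>

lemma texp_broken_path:
  fixes X Y :: "('n::finite, 'n, 'p::finite) tensor"
  assumes X: "X\<^sup>H = X" and Y: "Y\<^sup>H = Y"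
  defines "\<gamma> \<equiv> \<lambda>r. if r \<le> 0 then tfun exp ((- r) *\<^sub>R X) else tfun exp (r *\<^sub>R Y)"
  shows "piecewise_smooth_path (- 1) 1 \<gamma> (tfun exp X) (tfun exp Y)"
    "path_len (- 1) 1 \<gamma> = riem_norm X + riem_norm Y"
proof -
  have left: "\<gamma> r = tfun exp ((0 + r * (- 1)) *\<^sub>R X)" if "r \<in> {- 1..0}" for r
    using that by (simp add: \<gamma>_def)
  have right: "\<gamma> r = tfun exp ((0 + r * 1) *\<^sub>R Y)" if "r \<in> {0..1}" for r
    using that by (cases "r = 0") (simp_all add: \<gamma>_def)
  note l = texp_line[OF X _ left, of "- 1" 0, simplified]
  note r = texp_line[OF Y _ right, of 0 1, simplified]
  have "piecewise_smooth_on (- 1) 1 \<gamma>"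
    unfolding piecewise_smooth_on_def using l(1) r(1)
    by (intro exI[of _ 2] exI[of _ "\<lambda>i. real i - 1"]) (auto simp: less_2_cases_iff)
  moreover have "{- 1..1} = {- 1..0} \<union> {0..1::real}"
    by auto
  then have "\<gamma> ` {- 1..1} \<subseteq> T_pos_def"
    using l(2) r(2) by (simp only: image_Un Un_least)
  ultimately show "piecewise_smooth_path (- 1) 1 \<gamma> (tfun exp X) (tfun exp Y)"
    by (simp add: piecewise_smooth_path_def \<gamma>_def)
  have "(riem_speed \<gamma> has_integral riem_norm X + riem_norm Y) {- 1..1}"
    by (rule has_integral_combine[OF _ _ l(3) r(3)]) simp_all
  then show "path_len (- 1) 1 \<gamma> = riem_norm X + riem_norm Y"
    unfolding path_len_def by (rule integral_unique)
qed

lemma riem_dist_le_path_len: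
  assumes "piecewise_smooth_path a b \<gamma> A B"
  shows "riem_dist A B \<le> path_len a b \<gamma>"
proof -
  have "A \<in> T_pos_def" "B \<in> T_pos_def"
    using assms by (auto simp: piecewise_smooth_path_def)
  moreover have "Inf (path_lens A B) \<le> path_len a b \<gamma>"
  proof (rule cInf_lower)
    show "path_len a b \<gamma> \<in> path_lens A B"
      using assms by blast
    have "riem_norm (tfun ln B - tfun ln A) \<le> x" if "x \<in> path_lens A B" for x
      using that piecewise_smooth_path_length by blast
    then show "bdd_below (path_lens A B)"
      by (rule bdd_belowI)
  qed
  ultimately show ?thesis
    by (simp add: riem_dist_def)
qed

lemma riem_dist_broken:
  assumes "X\<^sup>H = X" "Y\<^sup>H = Y"
  shows "riem_dist (tfun exp X) (tfun exp Y) \<le> riem_norm X + riem_norm Y"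
  using riem_dist_le_path_len[OF texp_broken_path(1)[OF assms]] by (simp add: texp_broken_path(2)[OF assms])

lemma tlog_nonexpansive:
  assumes "A \<in> T_pos_def" "B \<in> T_pos_def"
  shows "riem_norm (tfun ln B - tfun ln A) \<le> riem_dist A B"
proof -
  have "tfun ln A\<^sup>H = tfun ln A" "tfun ln B\<^sup>H = tfun ln B"
    using assms by (simp_all add: tfun_hermitian T_pos_def_hermitian)
  then have "\<exists>x. x \<in> path_lens A B"
    using texp_broken_path(1)[of "tfun ln A" "tfun ln B"] assms
    by (auto simp: texp_tlog tfun_hermitian T_pos_def_hermitian)
  then have "riem_norm (tfun ln B - tfun ln A) \<le> Inf (path_lens A B)"
    by (intro cInf_greatest) (use piecewise_smooth_path_length in blast)+
  then show ?thesis
    using assms by (simp add: riem_dist_def)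
qed

lemma texp_pos_def: "X\<^sup>H = X \<Longrightarrow> tfun exp X \<in> T_pos_def"
  by (simp add: tfun_pos_def)

lemma riem_dist_texp_ge:
  assumes "X\<^sup>H = X" "Y\<^sup>H = Y"
  shows "riem_norm (Y - X) \<le> riem_dist (tfun exp X) (tfun exp Y)"
  using tlog_nonexpansive[OF texp_pos_def texp_pos_def, OF assms] assms by (simp add: tlog_texp)

lemma riem_dist_texp_line:
  assumes X: "X\<^sup>H = X"
  shows "riem_dist (tfun exp (s *\<^sub>R X)) (tfun exp (t *\<^sub>R X)) = \<bar>t - s\<bar> * riem_norm X"
proof (rule antisym)
  show "riem_dist (tfun exp (s *\<^sub>R X)) (tfun exp (t *\<^sub>R X)) \<le> \<bar>t - s\<bar> * riem_norm X"
    using riem_dist_le_path_len[OF texp_path(1)[OF X]] by (simp only: texp_path(2)[OF X])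
  show "\<bar>t - s\<bar> * riem_norm X \<le> riem_dist (tfun exp (s *\<^sub>R X)) (tfun exp (t *\<^sub>R X))"
    using riem_dist_texp_ge[OF hermitian_scaleR[OF X] hermitian_scaleR[OF X], of t s]
    by (simp add: riem_norm_scaleR flip: scaleR_diff_left)
qed

text \<open>The congruences act transitively: \<open>A\<close> is the image of the identity tensor under that by \<open>A\<^sup>1\<^sup>/\<^sup>2\<close>.\<close>

lemma congruence_normal_form:
  fixes A :: "('n::finite, 'n, 'p::finite) tensor"
  assumes A: "A \<in> T_pos_def"
  obtains G G' :: "('n, 'n, 'p) tensor" where "G \<star> G' = tident" "G' \<star> G = tident" "G \<star> G\<^sup>H = A"
proof -
  note herm = T_pos_def_hermitian[OF A]
  define G where "G = tfun sqrt A"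
  define G' where "G' = tfun (\<lambda>s. inverse (sqrt s)) A"
  have "G \<star> G' = tfun (\<lambda>s. 1) A" "G' \<star> G = tfun (\<lambda>s. 1) A" "G \<star> G = tfun (\<lambda>s. s) A"
    unfolding G_def G'_def tfun_mult[OF herm] by (rule tfun_cong_pos[OF A], simp)+
  moreover have "G\<^sup>H = G"
    unfolding G_def by (rule tfun_hermitian[OF herm])
  ultimately show thesis
    using that by (simp add: tfun_one[OF herm] tfun_id[OF herm])
qed

lemma congruence_texp:
  fixes A G G' :: "('n::finite, 'n, 'p::finite) tensor"
  assumes "A \<in> T_pos_def" and inv: "G \<star> G' = tident" "G' \<star> G = tident"
  obtains X where "X\<^sup>H = X" "G \<star> tfun exp X \<star> G\<^sup>H = A"
proof -
  let ?B = "G' \<star> A \<star> G'\<^sup>H"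
  have B: "?B \<in> T_pos_def"
    using T_pos_def_congruence[OF assms(1) inv(2)] .
  have "G \<star> ?B \<star> G\<^sup>H = A"
    by (simp add: tprod_assoc cancel_inverse[OF inv] inv_adjoint[OF inv])
  then show thesis
    using that[of "tfun ln ?B"] tfun_hermitian[OF T_pos_def_hermitian[OF B]] by (simp add: texp_tlog[OF B])
qed

text \<open>
  A congruence moves the middle point \<open>B\<close> to the identity tensor.  The distances from there are the
  norms of logarithms, and the broken path bounds the third distance by their sum.
\<close>

lemma Metric_space_riem_dist: "Metric_space (T_pos_def :: ('n::finite, 'n, 'p::finite) tensor set) riem_dist"
proof
  have dist_one: "riem_dist (tfun exp X) (tfun exp Y) = riem_norm X"
    if "X\<^sup>H = X" "Y = 0" for X Y :: "('n, 'n, 'p) tensor"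
    using riem_dist_texp_line[OF that(1), of 1 0] that(2) by simp
  have one_dist: "riem_dist (tfun exp Y) (tfun exp X) = riem_norm X"
    if "X\<^sup>H = X" "Y = 0" for X Y :: "('n, 'n, 'p) tensor"
    using riem_dist_texp_line[OF that(1), of 0 1] that(2) by simp
  have texp_0: "tfun exp (0 :: ('n, 'n, 'p) tensor) = tident"
  proof -
    have herm: "tident\<^sup>H = (tident :: ('n, 'n, 'p) tensor)"
      by simp
    have "tfun exp (0 *\<^sub>R tident :: ('n, 'n, 'p) tensor) = tfun (\<lambda>s. 1) tident"
      unfolding tfun_scaleR[OF herm] by simp
    then show ?thesis
      by (simp add: tfun_one[OF herm])
  qed
  have herm0: "0\<^sup>H = (0 :: ('n, 'n, 'p) tensor)"
    by (rule linear_0[OF linear_tadjoint])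
  have congr: "\<exists>(X :: ('n, 'n, 'p) tensor) (Y :: ('n, 'n, 'p) tensor). X\<^sup>H = X \<and> Y\<^sup>H = Y \<and> riem_dist A B = riem_norm X \<and> riem_dist B A = riem_norm X \<and>
      riem_dist B C = riem_norm Y \<and> riem_dist A C \<le> riem_norm X + riem_norm Y"
    if A: "A \<in> T_pos_def" and B: "B \<in> T_pos_def" and C: "C \<in> T_pos_def" for A B C :: "('n, 'n, 'p) tensor"
  proof -
    obtain G G' :: "('n, 'n, 'p) tensor" where inv: "G \<star> G' = tident" "G' \<star> G = tident" and "G \<star> G\<^sup>H = B"
      using congruence_normal_form[OF B] by metis
    then have B': "G \<star> tfun exp 0 \<star> G\<^sup>H = B"
      by (simp add: texp_0)
    obtain X where X: "X\<^sup>H = X" "G \<star> tfun exp X \<star> G\<^sup>H = A"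
      using congruence_texp[OF A inv] by metis
    obtain Y where Y: "Y\<^sup>H = Y" "G \<star> tfun exp Y \<star> G\<^sup>H = C"
      using congruence_texp[OF C inv] by metis
    note dist = riem_dist_congruence[OF inv texp_pos_def texp_pos_def]
    have "riem_dist A B = riem_norm X"
      using dist[OF X(1) herm0] by (simp only: X(2) B' dist_one[OF X(1) refl])
    moreover have "riem_dist B A = riem_norm X"
      using dist[OF herm0 X(1)] by (simp only: X(2) B' one_dist[OF X(1) refl])
    moreover have "riem_dist B C = riem_norm Y"
      using dist[OF herm0 Y(1)] by (simp only: Y(2) B' one_dist[OF Y(1) refl])
    moreover have "riem_dist A C \<le> riem_norm X + riem_norm Y"
      using dist[OF X(1) Y(1)] riem_dist_broken[OF X(1) Y(1)] by (simp only: X(2) Y(2))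
    ultimately show ?thesis
      using X(1) Y(1) by metis
  qed
  fix A B C :: "('n, 'n, 'p) tensor"
  show "0 \<le> riem_dist A B"
  proof (cases "A \<in> T_pos_def \<and> B \<in> T_pos_def")
    case True
    then show ?thesis
      using tlog_nonexpansive[of A B] riem_norm_nonneg order_trans by blast
  qed (auto simp: riem_dist_def)
  show "riem_dist A B = riem_dist B A"
  proof (cases "A \<in> T_pos_def \<and> B \<in> T_pos_def")
    case True
    then show ?thesis
      using congr[of A B B] by auto
  qed (auto simp: riem_dist_def)
  assume AB: "A \<in> T_pos_def" "B \<in> T_pos_def"
  show "riem_dist A B = 0 \<longleftrightarrow> A = B"
  proof
    assume "riem_dist A B = 0"
    then have "tfun ln A = tfun ln B"
      using tlog_nonexpansive[OF AB] by (simp add: riem_norm_def mult_le_0_iff)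
    then show "A = B"
      by (metis AB texp_tlog)
  next
    assume "A = B"
    have "riem_dist (tfun exp (1 *\<^sub>R tfun ln B)) (tfun exp (1 *\<^sub>R tfun ln B)) = 0"
      by (subst riem_dist_texp_line) (simp_all add: tfun_hermitian T_pos_def_hermitian AB)
    then show "riem_dist A B = 0"
      by (simp add: \<open>A = B\<close> texp_tlog[OF AB(2)])
  qed
  assume C: "C \<in> T_pos_def"
  show "riem_dist A C \<le> riem_dist A B + riem_dist B C"
    using congr[OF AB C] by auto
qed

text \<open>
  By homogeneity the point of division \<open>c t\<close> may be taken to be the identity tensor, and then \<open>A\<close>, \<open>B\<close>,
  \<open>C\<close> are the exponentials of \<open>- t X\<close>, \<open>(1 - t) X\<close>, \<open>Y\<close>.  The distance of \<open>A\<close> and \<open>B\<close> and that of \<open>c t\<close> and \<open>C\<close>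
  equal those of the logarithms, the distances from \<open>A\<close> and \<open>B\<close> to \<open>C\<close> are at least those of the
  logarithms, and for the logarithms Stewart's theorem is an equality.
\<close>

lemma riem_dist_Stewart:
  fixes A B :: "('n::finite, 'n, 'p::finite) tensor"
  assumes A: "A \<in> T_pos_def" and B: "B \<in> T_pos_def"
  shows "\<exists>c. c 0 = A \<and> c 1 = B \<and> (\<forall>t. c t \<in> T_pos_def) \<and>
    (\<forall>s t. riem_dist (c s) (c t) = \<bar>s - t\<bar> * riem_dist A B) \<and>
    (\<forall>t\<in>{0..1}. \<forall>C\<in>T_pos_def. (riem_dist (c t) C)\<^sup>2 \<le>
      (1 - t) * (riem_dist A C)\<^sup>2 + t * (riem_dist B C)\<^sup>2 - t * (1 - t) * (riem_dist A B)\<^sup>2)"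
proof -
  obtain G G' :: "('n, 'n, 'p) tensor" where inv: "G \<star> G' = tident" "G' \<star> G = tident" and GA: "G \<star> G\<^sup>H = A"
    using congruence_normal_form[OF A] by metis
  obtain X where X: "X\<^sup>H = X" and GB: "G \<star> tfun exp X \<star> G\<^sup>H = B"
    using congruence_texp[OF B inv] by metis
  define c where "c t = G \<star> tfun exp (t *\<^sub>R X) \<star> G\<^sup>H" for t
  have herm: "(t *\<^sub>R X)\<^sup>H = t *\<^sub>R X" for t
    by (rule hermitian_scaleR[OF X])
  have ends: "c 0 = A" "c 1 = B"
    using GA GB tfun_scaleR[OF X, of exp 0] by (simp_all add: c_def tfun_one[OF X])
  have pos: "c t \<in> T_pos_def" for t
    unfolding c_def by (rule T_pos_def_congruence[OF texp_pos_def[OF herm] inv(1)])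
  have dist_X: "riem_dist (c s) (c t) = \<bar>t - s\<bar> * riem_norm X" for s t
    unfolding c_def riem_dist_congruence[OF inv texp_pos_def[OF herm] texp_pos_def[OF herm]]
    by (rule riem_dist_texp_line[OF X])
  have AB: "riem_dist A B = riem_norm X"
    using dist_X[of 0 1] by (simp add: ends)
  have "(riem_dist (c t) C)\<^sup>2 \<le>
      (1 - t) * (riem_dist A C)\<^sup>2 + t * (riem_dist B C)\<^sup>2 - t * (1 - t) * (riem_dist A B)\<^sup>2"
    if t: "t \<in> {0..1}" and C: "C \<in> T_pos_def" for t C
  proof -
    define R where "R s = tfun exp (s *\<^sub>R X)" for s
    have R_add: "R r \<star> R s = R (r + s)" for r s
      by (simp add: R_def tfun_scaleR[OF X] tfun_mult[OF X] ring_distribs exp_add)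
    have R_0: "R 0 = tident"
      by (simp add: R_def tfun_scaleR[OF X, of exp 0, simplified] tfun_one[OF X])
    have R_adj: "(R s)\<^sup>H = R s" for s
      by (simp add: R_def tfun_hermitian herm)
    have R_add': "R r \<star> (R s \<star> Z) = R (r + s) \<star> Z" for r s Z
      by (simp add: R_add flip: tprod_assoc)
    \<comment> \<open>The congruence by \<open>K\<close> takes the identity tensor to \<open>G * exp (t X) * G\<^sup>H = c t\<close>.\<close>
    define K K' where "K = G \<star> R (t / 2)" and "K' = R (- t / 2) \<star> G'"
    have inv': "K \<star> K' = tident" "K' \<star> K = tident"
      by (simp_all add: K_def K'_def tprod_assoc R_add' R_add R_0 cancel_inverse[OF inv] inv)
    have c_eq: "c s = K \<star> tfun exp ((s - t) *\<^sub>R X) \<star> K\<^sup>H" for s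
      by (simp add: K_def c_def tadjoint_tprod R_adj tprod_assoc R_add' flip: R_def)
    obtain Y where Y: "Y\<^sup>H = Y" and KC: "K \<star> tfun exp Y \<star> K\<^sup>H = C"
      using congruence_texp[OF C inv'] by metis
    have dist_C: "riem_dist (c s) C = riem_dist (tfun exp ((s - t) *\<^sub>R X)) (tfun exp Y)" for s
      unfolding c_eq KC[symmetric] by (rule riem_dist_congruence[OF inv' texp_pos_def[OF herm] texp_pos_def[OF Y]])
    have ge: "(riem_norm (Y - (s - t) *\<^sub>R X))\<^sup>2 \<le> (riem_dist (c s) C)\<^sup>2" for s
      unfolding dist_C by (rule power_mono[OF riem_dist_texp_ge[OF herm Y] riem_norm_nonneg])
    have "riem_dist (c t) C = riem_norm Y"
      unfolding dist_C using riem_dist_texp_line[OF Y, of 0 1]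
      by (simp add: tfun_scaleR[OF X, of exp 0, simplified] tfun_scaleR[OF Y, of exp 0, simplified] tfun_one X Y)
    have sq: "(riem_norm Z)\<^sup>2 = real CARD('p) * (Z \<bullet> Z)" for Z :: "('n, 'n, 'p) tensor"
      by (simp add: riem_norm_def power_mult_distrib dot_square_norm)
    have "(riem_dist (c t) C)\<^sup>2 = (1 - t) * (riem_norm (Y - (0 - t) *\<^sub>R X))\<^sup>2
        + t * (riem_norm (Y - (1 - t) *\<^sub>R X))\<^sup>2 - t * (1 - t) * (riem_norm X)\<^sup>2"
      unfolding \<open>riem_dist (c t) C = riem_norm Y\<close> sq
      by (simp add: inner_diff inner_add inner_commute algebra_simps power2_eq_square)
    also have "\<dots> \<le> (1 - t) * (riem_dist (c 0) C)\<^sup>2 + t * (riem_dist (c 1) C)\<^sup>2 - t * (1 - t) * (riem_norm X)\<^sup>2"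
      using t by (intro diff_right_mono add_mono mult_left_mono ge) auto
    finally show ?thesis
      by (simp add: ends AB)
  qed
  with ends pos dist_X AB show ?thesis
    by (intro exI[of _ c]) (auto simp: abs_minus_commute)
qed

section \<open>From Stewart's inequality to the CAT(0) condition\<close>

text \<open>Stewart's theorem in a Euclidean space.\<close>

lemma dist_convex_combination_square:
  fixes a b z :: "'a::real_inner"
  shows "(dist ((1 - t) *\<^sub>R a + t *\<^sub>R b) z)\<^sup>2
    = (1 - t) * (dist a z)\<^sup>2 + t * (dist b z)\<^sup>2 - t * (1 - t) * (dist a b)\<^sup>2"
  unfolding dist_norm power2_norm_eq_inner
  by (simp add: inner_diff inner_add inner_commute algebra_simps power2_eq_square)

text \<open>
  \<open>x\<close> and \<open>x'\<close> divide their sides in the same ratio, and \<open>x\<close> satisfies Stewart's formula as an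
  inequality, whereas \<open>x'\<close> satisfies it with equality.
\<close>

definition Stewart_pair :: "'a set \<Rightarrow> ('a \<Rightarrow> 'a \<Rightarrow> real) \<Rightarrow> 'a \<Rightarrow> 'a \<Rightarrow> 'b::real_inner \<Rightarrow> 'b \<Rightarrow> 'a \<Rightarrow> 'b \<Rightarrow> bool" where
  "Stewart_pair M d a b a' b' x x' \<longleftrightarrow> x \<in> M \<and> (\<exists>t\<in>{0..1}. x' = (1 - t) *\<^sub>R a' + t *\<^sub>R b' \<and>
    (\<forall>z\<in>M. (d x z)\<^sup>2 \<le> (1 - t) * (d a z)\<^sup>2 + t * (d b z)\<^sup>2 - t * (1 - t) * (d a b)\<^sup>2))"

lemma Stewart_pair_le:
  assumes "Stewart_pair M d a b a' b' x x'" "z \<in> M" "d a b = dist a' b'"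
    and "d a z \<le> dist a' z'" "d b z \<le> dist b' z'" "0 \<le> d a z" "0 \<le> d b z"
  shows "d x z \<le> dist x' z'"
proof -
  obtain t where t: "0 \<le> t" "t \<le> 1" "x' = (1 - t) *\<^sub>R a' + t *\<^sub>R b'"
    and "(d x z)\<^sup>2 \<le> (1 - t) * (d a z)\<^sup>2 + t * (d b z)\<^sup>2 - t * (1 - t) * (d a b)\<^sup>2"
    using assms(1,2) by (auto simp: Stewart_pair_def)
  note this(4)
  also have "\<dots> \<le> (1 - t) * (dist a' z')\<^sup>2 + t * (dist b' z')\<^sup>2 - t * (1 - t) * (dist a' b')\<^sup>2"
    using t(1,2) assms by (intro diff_mono add_mono mult_left_mono power_mono) simp_all
  also have "\<dots> = (dist x' z')\<^sup>2"
    by (simp only: t(3) dist_convex_combination_square)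
  finally show ?thesis
    by (rule power2_le_imp_le) simp
qed

text \<open>
  A geodesic is determined by its end points: applied to a point \<open>x\<close> with \<open>d a x = t d a b\<close> and
  \<open>d x b = (1 - t) d a b\<close>, Stewart's inequality forces \<open>x\<close> to coincide with the point of division.
  Hence the inequality holds along every geodesic segment.
\<close>

lemma comparison_point_Stewart_pair:
  fixes a' b' x' :: "real ^ 2"
  assumes M: "Metric_space M d" and mem: "a \<in> M" "b \<in> M"
    and stewart: "\<And>t. t \<in> {0..1} \<Longrightarrow> c t \<in> M \<and>
      (\<forall>z\<in>M. (d (c t) z)\<^sup>2 \<le> (1 - t) * (d a z)\<^sup>2 + t * (d b z)\<^sup>2 - t * (1 - t) * (d a b)\<^sup>2)"
    and S: "geodesic_segment M d a b S" and ab: "dist a' b' = d a b"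
    and cmp: "comparison_point d a S a' b' x x'"
  shows "Stewart_pair M d a b a' b' x x'"
proof -
  interpret Metric_space M d by fact
  obtain l \<gamma> where l: "0 \<le> l" "\<gamma> 0 = a" "\<gamma> l = b" "S = \<gamma> ` {0..l}" "S \<subseteq> M"
    and geo: "\<And>s t. s \<in> {0..l} \<Longrightarrow> t \<in> {0..l} \<Longrightarrow> d (\<gamma> s) (\<gamma> t) = \<bar>s - t\<bar>"
    using S unfolding geodesic_segment_def by blast
  have xS: "x \<in> S" and x': "x' \<in> closed_segment a' b'" "dist a' x' = d a x"
    using cmp by (simp_all add: comparison_point_def)
  obtain u where u: "u \<in> {0..l}" "\<gamma> u = x"
    using xS l(4) by blast
  have xM: "x \<in> M"
    using xS l(5) by blast
  have dl: "d a b = l" and dax: "d a x = u" and dxb: "d b x = l - u"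
    using geo[of 0 l] geo[of 0 u] geo[of l u] u l(1-3) by auto
  obtain t where t: "t \<in> {0..1}" "x' = (1 - t) *\<^sub>R a' + t *\<^sub>R b'"
    using x'(1) by (auto simp: closed_segment_def)
  have tl: "t * l = u"
  proof -
    have "a' - x' = t *\<^sub>R (a' - b')"
      by (simp add: t(2) algebra_simps)
    then have "dist a' x' = t * dist a' b'"
      using t(1) by (simp add: dist_norm)
    then show ?thesis
      using ab x'(2) dl dax by simp
  qed
  have "(d (c t) x)\<^sup>2 \<le> (1 - t) * u\<^sup>2 + t * (l - u)\<^sup>2 - t * (1 - t) * l\<^sup>2"
    using stewart[OF t(1)] xM dl dax dxb by auto
  also have "\<dots> = 0"
    by (simp add: algebra_simps power2_eq_square flip: tl)
  finally have "c t = x"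
    using stewart[OF t(1)] xM by simp
  then show ?thesis
    unfolding Stewart_pair_def using t stewart[OF t(1)] by blast
qed

text \<open>
  Compare first the distance from \<open>x\<close> to each vertex, then that from \<open>y\<close> to \<open>x\<close>: in Stewart's formula
  the distances to the end points of the side have nonnegative coefficients, so that bounds for them
  carry over.  The set \<open>V\<close> of pairs of a vertex and its comparison vertex treats the three sides alike.
\<close>

lemma CAT0_space_of_Stewart:
  fixes d :: "'a \<Rightarrow> 'a \<Rightarrow> real"
  assumes M: "Metric_space M d"
    and stewart: "\<And>a b. a \<in> M \<Longrightarrow> b \<in> M \<Longrightarrow> \<exists>c. c 0 = a \<and> c 1 = b \<and> (\<forall>t. c t \<in> M) \<and>
      (\<forall>s t. d (c s) (c t) = \<bar>s - t\<bar> * d a b) \<and>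
      (\<forall>t\<in>{0..1}. \<forall>z\<in>M. (d (c t) z)\<^sup>2 \<le> (1 - t) * (d a z)\<^sup>2 + t * (d b z)\<^sup>2 - t * (1 - t) * (d a b)\<^sup>2)"
  shows "CAT0_space M d"
proof -
  interpret Metric_space M d by fact
  have "\<exists>S. geodesic_segment M d x y S" if xy: "x \<in> M" "y \<in> M" for x y
  proof -
    obtain c where c: "c 0 = x" "c 1 = y" "\<And>t. c t \<in> M" "\<And>s t. d (c s) (c t) = \<bar>s - t\<bar> * d x y"
      using stewart[OF xy] by metis
    have len: "\<bar>s / d x y - t / d x y\<bar> * d x y = \<bar>s - t\<bar>" if "s \<in> {0..d x y}" "t \<in> {0..d x y}" for s t
    proof (cases "d x y = 0")
      case False
      then have "d x y > 0"
        using nonneg[of x y] by linarith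
      then show ?thesis
        by (simp flip: diff_divide_distrib)
    qed (use that in auto)
    have "x = y" if "d x y = 0"
      using that xy by simp
    then have "c (d x y / d x y) = y"
      using c(1,2) by (cases "d x y = 0") auto
    then have "geodesic_segment M d x y ((\<lambda>s. c (s / d x y)) ` {0..d x y})"
      unfolding geodesic_segment_def using c len
      by (intro exI[of _ "d x y"] exI[of _ "\<lambda>s. c (s / d x y)"]) auto
    then show ?thesis
      by blast
  qed
  with M have "geodesic_space M d"
    by (simp add: geodesic_space_def)
  moreover have "d x y \<le> dist x' y'"
    if mem: "p \<in> M" "q \<in> M" "r \<in> M"
      and seg: "geodesic_segment M d p q S" "geodesic_segment M d q r T" "geodesic_segment M d r p U"
      and dist: "dist p' q' = d p q" "dist q' r' = d q r" "dist r' p' = d r p"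
      and x: "comparison_point d p S p' q' x x' \<or> comparison_point d q T q' r' x x' \<or>
        comparison_point d r U r' p' x x'"
      and y: "comparison_point d p S p' q' y y' \<or> comparison_point d q T q' r' y y' \<or>
        comparison_point d r U r' p' y y'"
    for p q r S T U x y and p' q' r' x' y' :: "real ^ 2"
  proof -
    define V where "V = {(p, p'), (q, q'), (r, r')}"
    have V: "v \<in> M" "w \<in> M" "d v w = dist v' w'" if "(v, v') \<in> V" "(w, w') \<in> V" for v v' w w'
      using that mem dist by (auto simp: V_def commute dist_commute)
    have pair: "\<exists>v v' w w'. (v, v') \<in> V \<and> (w, w') \<in> V \<and> Stewart_pair M d v w v' w' x x'"
      if "comparison_point d p S p' q' x x' \<or> comparison_point d q T q' r' x x' \<or>
        comparison_point d r U r' p' x x'" for x x'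
    proof -
      have st: "Stewart_pair M d v w v' w' x x'"
        if "geodesic_segment M d v w S" "comparison_point d v S v' w' x x'" "(v, v') \<in> V" "(w, w') \<in> V"
        for v w v' w' S
      proof -
        note vw = V[OF that(3,4)]
        obtain c where "\<And>t. c t \<in> M" "\<And>t. t \<in> {0..1} \<Longrightarrow>
            \<forall>z\<in>M. (d (c t) z)\<^sup>2 \<le> (1 - t) * (d v z)\<^sup>2 + t * (d w z)\<^sup>2 - t * (1 - t) * (d v w)\<^sup>2"
          using stewart[OF vw(1,2)] by metis
        then show ?thesis
          using comparison_point_Stewart_pair[OF M vw(1,2) _ that(1) vw(3)[symmetric] that(2), of c] by blast
      qed
      have "(p, p') \<in> V" "(q, q') \<in> V" "(r, r') \<in> V"
        by (simp_all add: V_def)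
      with that st seg show ?thesis
        by metis
    qed
    obtain a a' b b' where a: "(a, a') \<in> V" "(b, b') \<in> V" "Stewart_pair M d a b a' b' x x'"
      using pair[OF x] by blast
    obtain e e' f f' where e: "(e, e') \<in> V" "(f, f') \<in> V" "Stewart_pair M d e f e' f' y y'"
      using pair[OF y] by blast
    have "x \<in> M"
      using a(3) by (simp add: Stewart_pair_def)
    have vertex: "d v x \<le> dist v' x'" if v: "(v, v') \<in> V" for v v'
    proof -
      have "d x v \<le> dist x' v'"
        by (rule Stewart_pair_le[OF a(3) V(1)[OF v v] V(3)[OF a(1,2)]])
          (simp_all add: V(3)[OF a(1) v] V(3)[OF a(2) v])
      then show ?thesis
        by (simp add: commute dist_commute)
    qed
    have "d y x \<le> dist y' x'"
      by (rule Stewart_pair_le[OF e(3) \<open>x \<in> M\<close> V(3)[OF e(1,2)]]) (simp_all add: vertex e)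
    then show ?thesis
      by (simp add: commute dist_commute)
  qed
  ultimately show ?thesis
    unfolding CAT0_space_def Let_def by blast
qed

theorem corollary4p4:
  shows "CAT0_space (T_pos_def :: ('n::finite, 'n, 'p::finite) tensor set) riem_dist"
  using Metric_space_riem_dist riem_dist_Stewart by (rule CAT0_space_of_Stewart)

end
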